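(* Let $a,b\ge 1$ be integers, $n=a+b$, and suppose that the maximal parabolic subalgebra $\mathfrak p(a,b)\subset\mathfrak{sl}_n$ is Frobenius. Let $F\in\mathfrak p(a,b)^*$ be a Frobenius functional and let $\widehat F\in\mathfrak p(a,b)$ be its principal element. For $\lambda\in\mathbb Z$ let $d_\lambda$ and $\delta_\lambda$ be the dimensions of the $\lambda$-eigenspaces of $\operatorname{ad}_{\widehat F}$ acting on $\mathfrak p(a,b)$ and on $\mathfrak{gl}_n$, respectively. Then: (1) the sequence $(d_\lambda)_{\lambda\in\mathbb Z}$ is symmetric and unimodal about $\tfrac12$, i.e. $d_\lambda=d_{1-\lambda}$ for all $\lambda$, $d_\lambda\le d_{\lambda+1}$ for all $\lambda\le -1$, and $d_\lambda\ge d_{\lambda+1}$ for all $\lambda\ge 1$; (2) the sequence $(\delta_\lambda)_{\lambda\in\mathbb Z}$ is symmetric and unimodal about $0$, i.e. $\delta_\lambda=\delta_{-\lambda}$ for all $\lambda$, $\delta_\lambda\le\delta_{\lambda+1}$ for all $\lambda\le -1$, and $\delta_\lambda\ge\delta_{\lambda+1}$ for all $\lambda\ge 0$.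
   Context: Work over $\mathbb C$. For integers $a,b\ge1$ and $n=a+b$, $\mathfrak p(a,b)$ is the maximal parabolic subalgebra of $\mathfrak{sl}_n$ consisting of all trace-zero $n\times n$ matrices $X$ with $X_{i,j}=0$ whenever $i\in\{a+1,\dots,n\}$ and $j\in\{1,\dots,a\}$. For a finite-dimensional Lie algebra $\mathfrak L$ and $F\in\mathfrak L^*$, the Kirillov form is $B_F(x,y)=F([x,y])$. $\mathfrak L$ is Frobenius if $B_F$ is non-degenerate for some $F$; such an $F$ is called a Frobenius functional. (It is known that $\mathfrak p(a,b)$ is Frobenius if and only if $\gcd(a,b)=1$.) The principal element $\widehat F\in\mathfrak L$ of a Frobenius functional $F$ is the unique element with $F(y)=F([\widehat F,y])$ for all $y\in\mathfrak L$. For $\mathfrak L=\mathfrak p(a,b)$ Frobenius, it is known that $\operatorname{ad}_{\widehat F}$ acts semisimply with integer eigenvalues on $\mathfrak{gl}_n$, hence on $\mathfrak p(a,b)$. *)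

theory Defs
  imports "HOL-Analysis.Analysis"
begin

text \<open>
  The library has no complex scaling on \<open>complex^'n^'m\<close> (\<open>*s\<close> would take its scalar from
  \<open>complex^'n\<close>, and \<open>dim\<close> is the real dimension), so complex subspaces and complex
  dimensions of spaces of matrices come from the following instance of the locale \<open>vector_space\<close>.
\<close>

definition cmat_scale :: "complex \<Rightarrow> complex^'n^'m \<Rightarrow> complex^'n^'m" where
  "cmat_scale c X = (\<chi> i j. c * X $ i $ j)"

global_interpretation cmat: vector_space "cmat_scale :: complex \<Rightarrow> complex^'n^'m \<Rightarrow> complex^'n^'m"
  by unfold_locales (simp_all add: cmat_scale_def vec_eq_iff algebra_simps)

definition lie :: "complex^'n^'n \<Rightarrow> complex^'n^'n \<Rightarrow> complex^'n^'n" where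
  "lie X Y = X ** Y - Y ** X"

definition gl :: "(complex^'n^'n) set" where
  "gl = UNIV"

definition sl :: "(complex^'n^'n) set" where
  "sl = {X. trace X = 0}"

text \<open>
  \<open>\<pp>(a,b)\<close> with \<open>a = CARD('a)\<close>, \<open>b = CARD('b)\<close>: the indices \<open>Inl i\<close> stand for
  \<open>1,\<dots>,a\<close> and the indices \<open>Inr j\<close> for \<open>a+1,\<dots>,a+b\<close>.  The first index of
  \<open>X $ r $ c\<close> is the row.
\<close>

definition parabolic :: "(complex^('a::finite + 'b::finite)^('a + 'b)) set" where
  "parabolic = {X \<in> sl. \<forall>i j. X $ Inr i $ Inl j = 0}"

text \<open>
  Below \<open>L\<close> is a Lie algebra of matrices, given by its carrier.  An element of \<open>L\<^sup>*\<close> is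
  represented by any function on matrices that is complex linear on \<open>L\<close>; its values
  outside \<open>L\<close> are never used.
\<close>

definition lie_subalgebra :: "(complex^'n^'n) set \<Rightarrow> bool" where
  "lie_subalgebra L \<longleftrightarrow> cmat.subspace L \<and> (\<forall>x\<in>L. \<forall>y\<in>L. lie x y \<in> L)"

definition functional_on :: "(complex^'n^'n) set \<Rightarrow> (complex^'n^'n \<Rightarrow> complex) \<Rightarrow> bool" where
  "functional_on L F \<longleftrightarrow>
     (\<forall>x\<in>L. \<forall>y\<in>L. F (x + y) = F x + F y) \<and> (\<forall>c. \<forall>x\<in>L. F (cmat_scale c x) = c * F x)"

definition kirillov_form ::
    "(complex^'n^'n \<Rightarrow> complex) \<Rightarrow> complex^'n^'n \<Rightarrow> complex^'n^'n \<Rightarrow> complex" where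
  "kirillov_form F x y = F (lie x y)"

text \<open>One-sided non-degeneracy suffices, since Kirillov forms are alternating.\<close>

definition nondegenerate_on ::
    "(complex^'n^'n) set \<Rightarrow> (complex^'n^'n \<Rightarrow> complex^'n^'n \<Rightarrow> complex) \<Rightarrow> bool" where
  "nondegenerate_on L B \<longleftrightarrow> (\<forall>x\<in>L. (\<forall>y\<in>L. B x y = 0) \<longrightarrow> x = 0)"

definition frobenius_functional ::
    "(complex^'n^'n) set \<Rightarrow> (complex^'n^'n \<Rightarrow> complex) \<Rightarrow> bool" where
  "frobenius_functional L F \<longleftrightarrow> functional_on L F \<and> nondegenerate_on L (kirillov_form F)"

definition frobenius :: "(complex^'n^'n) set \<Rightarrow> bool" where
  "frobenius L \<longleftrightarrow> lie_subalgebra L \<and> (\<exists>F. frobenius_functional L F)"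

definition principal_element ::
    "(complex^'n^'n) set \<Rightarrow> (complex^'n^'n \<Rightarrow> complex) \<Rightarrow> complex^'n^'n \<Rightarrow> bool" where
  "principal_element L F H \<longleftrightarrow> H \<in> L \<and> (\<forall>y\<in>L. F y = F (lie H y))"

definition ad_eigenspace ::
    "(complex^'n^'n) set \<Rightarrow> complex^'n^'n \<Rightarrow> complex \<Rightarrow> (complex^'n^'n) set" where
  "ad_eigenspace L H c = {x \<in> L. lie H x = cmat_scale c x}"

lemma cmat_scale_component [simp]: "cmat_scale c X $ i $ j = c * X $ i $ j"
  by (simp add: cmat_scale_def)

lemma lie_subalgebra_parabolic:
  "lie_subalgebra (parabolic :: (complex^('a::finite + 'b::finite)^('a + 'b)) set)"
proof -
  let ?P = "parabolic :: (complex^('a + 'b)^('a + 'b)) set"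
  have "cmat.subspace ?P"
    unfolding cmat.subspace_def parabolic_def sl_def
    by (auto simp: trace_def sum.distrib simp flip: sum_distrib_left)
  moreover have "lie x y \<in> ?P" if xy: "x \<in> ?P" "y \<in> ?P" for x y
  proof -
    have "trace (lie x y) = 0"
      by (simp add: lie_def trace_sub trace_mul_sym[of x y])
    moreover have "(u ** v) $ Inr i $ Inl j = 0" if "u \<in> ?P" "v \<in> ?P" for u v i j
    proof -
      have "u $ Inr i $ k * v $ k $ Inl j = 0" for k
        using that by (cases k) (auto simp: parabolic_def)
      then have "(\<Sum>k\<in>UNIV. u $ Inr i $ k * v $ k $ Inl j) = 0"
        by (simp only: sum.neutral_const)
      then show ?thesis
        by (simp add: matrix_matrix_mult_def)
    qed
    ultimately show ?thesis
      using xy by (simp add: parabolic_def sl_def lie_def)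
  qed
  ultimately show ?thesis
    by (simp add: lie_subalgebra_def)
qed

lemma principal_element_unique:
  assumes L: "lie_subalgebra L" and F: "frobenius_functional L F"
    and H: "principal_element L F H" and H': "principal_element L F H'"
  shows "H = H'"
proof -
  have mem: "H \<in> L" "H' \<in> L" and sub: "cmat.subspace L"
    using L H H' by (auto simp: lie_subalgebra_def principal_element_def)
  have diff: "H - H' \<in> L"
    using mem sub by (rule cmat.subspace_diff[rotated])
  have "kirillov_form F (H - H') y = 0" if y: "y \<in> L" for y
  proof -
    have brackets: "lie (H - H') y \<in> L" "lie H' y \<in> L"
      using L diff mem y by (auto simp: lie_subalgebra_def)
    have "lie H y = lie (H - H') y + lie H' y"
      by (simp add: lie_def matrix_matrix_mult_def vec_eq_iff algebra_simps sum_subtractf)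
    then have "F (lie H y) = F (lie (H - H') y) + F (lie H' y)"
      using F brackets by (simp add: frobenius_functional_def functional_on_def)
    moreover have "F (lie H y) = F (lie H' y)"
      using H H' y by (simp add: principal_element_def)
    ultimately show ?thesis
      by (simp add: kirillov_form_def)
  qed
  then have "H - H' = 0"
    using F diff by (auto simp: frobenius_functional_def nondegenerate_on_def)
  then show ?thesis
    by simp
qed

end

(*
  Write F(x) = tr(Mx) and let U be the invariant subspace, W = V/U.  Modulo the irrelevant block
  Hom(W,U), M has blocks A in End(U), C in Hom(U,W), D in End(W), and non-degeneracy forces C to be
  injective or surjective.  If C is injective, the functional restricts to a Frobenius functional
  of the maximal parabolic subalgebra of gl(W) fixing C(U), and the principal element restricts to
  the principal element there; the surjective case is dual.  This Euclidean descent ends at gl_1.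
  Climbing back up, one sees that the principal element is semisimple with integral weight
  differences, and since C lowers weights by 1, the multiplicities (u, w) of the weights on U and W
  arise from (1, 0) or (0, 1) by the steps (u, w) -> (tu, u + w) and (u, w) -> (u + w, w/t) on
  Laurent polynomials.

  Put a(t) = u(t)u(1/t), b(t) = w(t)w(1/t), c(t) = u(t)w(1/t).  The steps replace (a, b, c) by
  (a, s, t(a + c)) and (s, b, t(b + c)), where s(t) = a(t) + b(t) + c(t) + c(1/t).  By induction a and b
  are symmetric unimodal, c_m <= c_k whenever m <= k and m + k <= 0, and a + b + c - 1 is symmetric
  about 1/2.  Since delta = s and d = a + b + c - 1, this gives the theorem.
*)
theory Submission
  imports Defs
begin

section \<open>Correlations of weight multiplicities\<close>

text \<open>The dimensions of U and W change at every step of the descent, but the ambient matrices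
  do not: spaces are represented by idempotents of one fixed matrix ring, and restriction to W
  replaces the pair \<open>P\<close>, \<open>Q\<close> by \<open>C * G\<close>,
  \<open>Q - C * G\<close>. Injectivity of C thus appears as a left inverse \<open>G\<close>, and
  dimensions appear as traces of idempotents.

  The stabilizers met on the way live in gl rather than sl. Scalars lie in the radical of their
  Kirillov forms, so non-degeneracy is stated modulo central elements, and weights are fixed only up
  to a common central offset.

  The one-sided condition on c is dictated by the symmetry of d. For l >= 1 that symmetry reduces
  s(l) - s(l-1) to c(-l) - c(l-1), up to an indicator of favourable sign, and d(l+1) - d(l) to c(-l)
  - c(l). The comparisons of c for m <= k and m + k <= 0 cover both differences, and they survive
  the factor t in either step.\<close>

text \<open>The coefficient of t to the power l in f(t)g(1/t): the dimension of the weight l part of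
  Hom from a space with multiplicities g to one with multiplicities f. Summing over the support of g
  keeps the sum finite.\<close>

definition corr :: "(int \<Rightarrow> nat) \<Rightarrow> (int \<Rightarrow> nat) \<Rightarrow> int \<Rightarrow> nat" where
  "corr f g l = (\<Sum>k | g k \<noteq> 0. f (k + l) * g k)"

lemma corr_superset:
  assumes "finite S" "{k. g k \<noteq> 0} \<subseteq> S"
  shows "corr f g l = (\<Sum>k\<in>S. f (k + l) * g k)"
  unfolding corr_def using assms by (intro sum.mono_neutral_left) auto

lemma corr_add_left: "corr (\<lambda>k. f k + f' k) g l = corr f g l + corr f' g l"
  by (simp add: corr_def algebra_simps sum.distrib)

lemma corr_add_right:
  assumes "finite {k. g k \<noteq> 0}" "finite {k. g' k \<noteq> 0}"
  shows "corr f (\<lambda>k. g k + g' k) l = corr f g l + corr f g' l"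
proof -
  let ?S = "{k. g k \<noteq> 0} \<union> {k. g' k \<noteq> 0}"
  have S: "finite ?S" using assms by simp
  have "corr f (\<lambda>k. g k + g' k) l = (\<Sum>k\<in>?S. f (k + l) * (g k + g' k))"
    by (rule corr_superset[OF S]) auto
  moreover have "corr f g l = (\<Sum>k\<in>?S. f (k + l) * g k)"
    by (rule corr_superset[OF S]) auto
  moreover have "corr f g' l = (\<Sum>k\<in>?S. f (k + l) * g' k)"
    by (rule corr_superset[OF S]) auto
  ultimately show ?thesis
    by (simp add: algebra_simps sum.distrib)
qed

lemma corr_commute:
  assumes "finite {k. f k \<noteq> 0}" "finite {k. g k \<noteq> 0}"
  shows "corr g f (- l) = corr f g l"
proof -
  \<comment> \<open>Chosen to contain the support of f and, after subtracting l, the support of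
    g.\<close>
  let ?S = "{k. f k \<noteq> 0} \<union> (\<lambda>k. k + l) ` {k. g k \<noteq> 0}"
  have S: "finite ?S" using assms by simp
  have "corr g f (- l) = (\<Sum>k\<in>?S. g (k + - l) * f k)"
    by (rule corr_superset[OF S]) auto
  also have "\<dots> = (\<Sum>k\<in>(\<lambda>k. k - l) ` ?S. f (k + l) * g k)"
    by (subst sum.reindex) (auto simp: inj_on_def mult.commute intro!: sum.cong)
  also have "\<dots> = corr f g l"
    by (rule corr_superset[symmetric]) (use S in \<open>force simp: image_iff\<close>)+
  finally show ?thesis .
qed

lemma corr_shift_left: "corr (\<lambda>k. f (k - 1)) g l = corr f g (l - 1)"
  by (simp add: corr_def algebra_simps)

lemma corr_shift_right: "corr f (\<lambda>k. g (k + 1)) l = corr f g (l - 1)"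
  unfolding corr_def
  by (rule sum.reindex_bij_witness[of _ "\<lambda>k. k - 1" "\<lambda>k. k + 1"]) (auto simp: algebra_simps)

text \<open>
  The pairs of weight multiplicities (on \<open>U\<close> and on \<open>W\<close>) produced by the Euclidean descent.  The
  rules \<open>inj\<close> and \<open>surj\<close> correspond to an injective, respectively surjective, map of weight \<open>-1\<close>
  from \<open>U\<close> to \<open>W\<close>.
\<close>

inductive weight_pair :: "(int \<Rightarrow> nat) \<Rightarrow> (int \<Rightarrow> nat) \<Rightarrow> bool" where
  left: "weight_pair (\<lambda>k. if k = 0 then 1 else 0) (\<lambda>k. 0)"
| right: "weight_pair (\<lambda>k. 0) (\<lambda>k. if k = 0 then 1 else 0)"
| inj: "weight_pair u w \<Longrightarrow> weight_pair (\<lambda>k. u (k - 1)) (\<lambda>k. u k + w k)"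
| surj: "weight_pair u w \<Longrightarrow> weight_pair (\<lambda>k. u k + w k) (\<lambda>k. w (k + 1))"

text \<open>In the dual of V the annihilator of U is dual to W, and weights change sign. An
  injective map transposes to a surjective one, so the rules \<open>inj\<close> and
  \<open>surj\<close> swap.\<close>

lemma weight_pair_dual: "weight_pair u w \<Longrightarrow> weight_pair (\<lambda>k. w (- k)) (\<lambda>k. u (- k))"
proof (induction rule: weight_pair.induct)
  case (inj u w)
  from weight_pair.surj[OF inj.IH] show ?case by (simp add: add.commute)
next
  case (surj u w)
  from weight_pair.inj[OF surj.IH] show ?case by (simp add: add.commute)
qed (use weight_pair.left weight_pair.right in simp_all)

section \<open>Symmetry and unimodality of the weight multiplicities\<close>

definition even_unimodal :: "(int \<Rightarrow> nat) \<Rightarrow> bool" where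
  "even_unimodal f \<longleftrightarrow> (\<forall>l m. \<bar>l\<bar> \<le> \<bar>m\<bar> \<longrightarrow> f m \<le> f l)"

lemma even_unimodal_even: "even_unimodal f \<Longrightarrow> f (- l) = f l"
  unfolding even_unimodal_def by (intro antisym) auto

lemma even_unimodalI:
  assumes even: "\<And>l. f (- l) = f l" and step: "\<And>l. l \<ge> 1 \<Longrightarrow> f l \<le> f (l - 1)"
  shows "even_unimodal f"
proof -
  have mono: "f (int (l + d)) \<le> f (int l)" for l d
  proof (induction d)
    case (Suc d)
    have "f (int (l + Suc d)) \<le> f (int (l + d))"
      using step[of "int (l + Suc d)"] by simp
    with Suc show ?case by simp
  qed simp
  have abs: "f \<bar>l\<bar> = f l" for l
    using even[of l] by (simp add: abs_if)
  have "f m \<le> f l" if "\<bar>l\<bar> \<le> \<bar>m\<bar>" for l m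
    using mono[of "nat \<bar>l\<bar>" "nat \<bar>m\<bar> - nat \<bar>l\<bar>"] that abs[of l] abs[of m] by simp
  then show ?thesis by (simp add: even_unimodal_def)
qed

text \<open>The invariant of the climb. The conditions \<open>m \<le> k\<close> and
  \<open>m + k \<le> 0\<close> together say that m is at most -|k|. The last clause is d(l) = d(1 -
  l) for d = a + b + c - [l = 0]: the indicators are moved across to avoid truncated subtraction,
  and a(1 - l), b(1 - l) are rewritten by evenness.\<close>

definition balanced :: "(int \<Rightarrow> nat) \<Rightarrow> (int \<Rightarrow> nat) \<Rightarrow> bool" where
  "balanced u w \<longleftrightarrow> finite {k. u k \<noteq> 0} \<and> finite {k. w k \<noteq> 0} \<and>
     even_unimodal (corr u u) \<and> even_unimodal (corr w w) \<and>
     (\<forall>m k. m \<le> k \<longrightarrow> m + k \<le> 0 \<longrightarrow> corr u w m \<le> corr u w k) \<and>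
     (\<forall>l. corr u u l + corr w w l + corr u w l + of_bool (l = 1) =
          corr u u (l - 1) + corr w w (l - 1) + corr u w (1 - l) + of_bool (l = 0))"

text \<open>The coefficients of s: all four blocks of gl(V), with Hom(U,W) entering as the
  reflection of Hom(W,U).\<close>

definition total_corr :: "(int \<Rightarrow> nat) \<Rightarrow> (int \<Rightarrow> nat) \<Rightarrow> int \<Rightarrow> nat" where
  "total_corr u w l = corr u u l + corr w w l + corr u w l + corr u w (- l)"

text \<open>The last clause of \<open>balanced\<close> cancels everything in s(l) - s(l-1) except
  c(-l) - c(l-1) and an indicator of favourable sign. The comparison of c applies because -l <= l -
  1 for l >= 1 and the two arguments add up to -1.\<close>

lemma balanced_total:
  assumes "balanced u w"
  shows "even_unimodal (total_corr u w)"
proof (rule even_unimodalI)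
  have A: "even_unimodal (corr u u)" and B: "even_unimodal (corr w w)"
    using assms by (auto simp: balanced_def)
  show "total_corr u w (- l) = total_corr u w l" for l
    using even_unimodal_even[OF A, of l] even_unimodal_even[OF B, of l] by (simp add: total_corr_def)
  fix l :: int assume l: "l \<ge> 1"
  then have "corr u w (- l) \<le> corr u w (l - 1)"
    using assms by (auto simp: balanced_def)
  moreover have "corr u u l + corr w w l + corr u w l + of_bool (l = 1) =
          corr u u (l - 1) + corr w w (l - 1) + corr u w (1 - l) + of_bool (l = 0)"
    using assms unfolding balanced_def by blast
  ultimately show "total_corr u w l \<le> total_corr u w (l - 1)"
    using l by (simp add: total_corr_def)
qed

text \<open>Reversing and swapping the sequences exchanges a and b and fixes c, so the invariant is
  self-dual. This reduces the surjective step to the injective one.\<close>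

lemma balanced_dual:
  assumes "balanced u w"
  shows "balanced (\<lambda>k. w (- k)) (\<lambda>k. u (- k))"
proof -
  have fin: "finite {k. f (- k) \<noteq> 0}" if "finite {k. f k \<noteq> 0}" for f :: "int \<Rightarrow> nat"
  proof -
    have "{k. f (- k) \<noteq> 0} = uminus ` {k. f k \<noteq> 0}"
      by (auto simp: image_iff) (metis minus_minus)
    then show ?thesis using that by simp
  qed
  have refl: "corr (\<lambda>k. f (- k)) (\<lambda>k. g (- k)) l = corr f g (- l)" for f g l
    unfolding corr_def by (rule sum.reindex_bij_witness[of _ uminus uminus]) (auto simp: algebra_simps)
  have uw: "finite {k. u k \<noteq> 0}" "finite {k. w k \<noteq> 0}"
    using assms by (auto simp: balanced_def)
  have [simp]: "corr w w (- l) = corr w w l" "corr u u (- l) = corr u u l" for l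
    using uw corr_commute by auto
  have [simp]: "corr u u (1 - l) = corr u u (l - 1)" "corr w w (1 - l) = corr w w (l - 1)" for l
    using uw corr_commute[of u u "l - 1"] corr_commute[of w w "l - 1"] by simp_all
  have c: "corr (\<lambda>k. w (- k)) (\<lambda>k. u (- k)) = corr u w"
    and a: "corr (\<lambda>k. w (- k)) (\<lambda>k. w (- k)) = corr w w"
    and b: "corr (\<lambda>k. u (- k)) (\<lambda>k. u (- k)) = corr u u"
    using corr_commute[OF uw] by (auto simp: refl fun_eq_iff)
  show ?thesis
    using assms fin uw unfolding balanced_def c a b by (simp add: algebra_simps)
qed

text \<open>For (a, s, t(a + c)) the terms in a cancel from the new symmetry by evenness, and the
  rest is the old symmetry rearranged. The factor t lowers both m and k by 1, which preserves m <= k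
  and m + k <= 0, so neither a nor c decreases from m - 1 to k - 1.\<close>

lemma balanced_inj:
  assumes "balanced u w"
  shows "balanced (\<lambda>k. u (k - 1)) (\<lambda>k. u k + w k)"
proof -
  have uw: "finite {k. u k \<noteq> 0}" "finite {k. w k \<noteq> 0}"
    and A: "even_unimodal (corr u u)"
    and c: "\<And>m k. m \<le> k \<Longrightarrow> m + k \<le> 0 \<Longrightarrow> corr u w m \<le> corr u w k"
    and sym: "\<And>l. corr u u l + corr w w l + corr u w l + of_bool (l = 1) =
          corr u u (l - 1) + corr w w (l - 1) + corr u w (1 - l) + of_bool (l = 0)"
    using assms by (auto simp: balanced_def)
  have "{k. u (k - 1) \<noteq> 0} = (\<lambda>k. k + 1) ` {k. u k \<noteq> 0}"
    by (auto simp: image_iff) (metis diff_add_cancel)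
  then have fin1: "finite {k. u (k - 1) \<noteq> 0}" using uw by simp
  have fin2: "finite {k. u k + w k \<noteq> 0}"
    by (rule finite_subset[of _ "{k. u k \<noteq> 0} \<union> {k. w k \<noteq> 0}"]) (use uw in auto)
  have A': "corr (\<lambda>k. u (k - 1)) (\<lambda>k. u (k - 1)) = corr u u"
    using corr_shift_right[of _ "\<lambda>k. u (k - 1)"] corr_shift_left[of u "\<lambda>k. u (k - 1)"]
    by (simp add: fun_eq_iff)
  have B': "corr (\<lambda>k. u k + w k) (\<lambda>k. u k + w k) = total_corr u w"
  proof
    fix l
    show "corr (\<lambda>k. u k + w k) (\<lambda>k. u k + w k) l = total_corr u w l"
      using corr_commute[OF uw, of "- l"]
      by (simp add: corr_add_left corr_add_right[OF uw] total_corr_def)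
  qed
  have C': "corr (\<lambda>k. u (k - 1)) (\<lambda>k. u k + w k) = (\<lambda>l. corr u u (l - 1) + corr u w (l - 1))"
    by (simp add: fun_eq_iff corr_shift_left corr_add_right[OF uw])
  have "corr u u (m - 1) + corr u w (m - 1) \<le> corr u u (k - 1) + corr u w (k - 1)"
    if "m \<le> k" "m + k \<le> 0" for m k
    using A c[of "m - 1" "k - 1"] that unfolding even_unimodal_def by (intro add_mono) auto
  moreover have "corr u u l + total_corr u w l + (corr u u (l - 1) + corr u w (l - 1)) + of_bool (l = 1) =
      corr u u (l - 1) + total_corr u w (l - 1) + (corr u u (1 - l - 1) + corr u w (1 - l - 1)) + of_bool (l = 0)"
    for l
    using sym[of l] even_unimodal_even[OF A, of l] by (simp add: total_corr_def)
  ultimately show ?thesis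
    using fin1 fin2 A balanced_total[OF assms] unfolding balanced_def A' B' C' by blast
qed

lemma balanced_surj:
  assumes "balanced u w"
  shows "balanced (\<lambda>k. u k + w k) (\<lambda>k. w (k + 1))"
  using balanced_dual[OF balanced_inj[OF balanced_dual[OF assms]]] by (simp add: add.commute)

lemma weight_pair_balanced: "weight_pair u w \<Longrightarrow> balanced u w"
proof (induction rule: weight_pair.induct)
  case left
  show ?case by (simp add: balanced_def even_unimodal_def corr_def if_distrib cong: if_cong)
next
  case right
  show ?case by (simp add: balanced_def even_unimodal_def corr_def if_distrib cong: if_cong)
qed (auto intro: balanced_inj balanced_surj)

text \<open>For l >= 1 the symmetry gives d(l+1) - d(l) = c(-l) - c(l), which is at most 0; the
  inequalities for l <= -1 are its mirror image.\<close>

lemma balanced_unimodal: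
  assumes "balanced u w"
    and d: "\<And>l. d l + of_bool (l = 0) = corr u u l + corr w w l + corr u w l"
    and \<delta>: "\<And>l. \<delta> l = total_corr u w l"
  shows "((\<forall>l. d l = d (1 - l)) \<and> (\<forall>l\<le>-1. d l \<le> d (l + 1)) \<and> (\<forall>l\<ge>1. d l \<ge> d (l + 1))) \<and>
         ((\<forall>l. \<delta> l = \<delta> (- l)) \<and> (\<forall>l\<le>-1. \<delta> l \<le> \<delta> (l + 1)) \<and> (\<forall>l\<ge>0. \<delta> l \<ge> \<delta> (l + 1)))"
proof -
  have A: "even_unimodal (corr u u)" and B: "even_unimodal (corr w w)"
    and c: "\<And>m k. m \<le> k \<Longrightarrow> m + k \<le> 0 \<Longrightarrow> corr u w m \<le> corr u w k"
    and sym: "\<And>l. corr u u l + corr w w l + corr u w l + of_bool (l = 1) =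
          corr u u (l - 1) + corr w w (l - 1) + corr u w (1 - l) + of_bool (l = 0)"
    using assms(1) by (auto simp: balanced_def)
  have "corr u u (1 - l) = corr u u (l - 1)" "corr w w (1 - l) = corr w w (l - 1)" for l
    using even_unimodal_even[OF A, of "l - 1"] even_unimodal_even[OF B, of "l - 1"] by simp_all
  then have d_sym: "d l = d (1 - l)" for l
    using d[of l] d[of "1 - l"] sym[of l] by (simp split: if_splits)
  have d_mono: "d (l + 1) \<le> d l" if "l \<ge> 1" for l
    using d[of l] d[of "l + 1"] sym[of "l + 1"] c[of "- l" l] that by simp
  have "d l \<le> d (l + 1)" if "l \<le> -1" for l
    using d_mono[of "- l"] d_sym[of l] d_sym[of "l + 1"] that by simp
  moreover have "even_unimodal \<delta>"
    using balanced_total[OF assms(1)] \<delta> by (simp add: even_unimodal_def)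
  ultimately show ?thesis
    using d_sym d_mono even_unimodal_even[of \<delta>] unfolding even_unimodal_def by auto
qed

section \<open>The Euclidean descent\<close>

text \<open>Turns an identity for a product of two factors into a rewrite rule that also fires
  inside longer, right-nested products.\<close>

lemma mult_extend: "a * b = c \<Longrightarrow> a * (b * x) = c * (x :: 'a :: semigroup_mult)"
  by (simp flip: mult.assoc)

text \<open>The Peirce corner e R f. For idempotent matrices it is Hom from the image of f to the
  image of e.\<close>

definition in_corner :: "'r \<Rightarrow> 'r \<Rightarrow> 'r :: ring_1 \<Rightarrow> bool" where
  "in_corner e f x \<longleftrightarrow> e * x = x \<and> x * f = x"

definition central :: "'r :: ring_1 \<Rightarrow> bool" where
  "central z \<longleftrightarrow> (\<forall>r. z * r = r * z)"

text \<open>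
  \<open>P\<close> and \<open>Q\<close> are the projections to the invariant subspace \<open>U\<close> and to a complement \<open>W\<close>.
  A functional on the stabilizer of \<open>U\<close> is the trace form with a matrix whose block in
  \<open>Hom(W,U)\<close> is irrelevant and whose other blocks are \<open>A\<close> in \<open>End(U)\<close>, \<open>C\<close> in \<open>Hom(U,W)\<close> and
  \<open>D\<close> in \<open>End(W)\<close>.  Below, \<open>stabilizer\<close> is non-degeneracy of the Kirillov form modulo
  scalars, and \<open>eqC\<close>, \<open>eqA\<close>, \<open>eqD\<close> say that the element with blocks \<open>X\<close>, \<open>Y\<close>, \<open>N\<close> is principal.
\<close>

locale parabolic_blocks =
  fixes P Q A C D :: "'r :: ring_1"
  assumes PP: "P * P = P" and QQ: "Q * Q = Q" and PQ: "P * Q = 0" and QP: "Q * P = 0"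
    and A: "in_corner P P A" and C: "in_corner Q P C" and D: "in_corner Q Q D"

locale frobenius_blocks = parabolic_blocks +
  assumes stabilizer: "\<And>x y N. \<lbrakk>in_corner P P x; in_corner Q Q y; in_corner P Q N;
      C * x = y * C; A * x - x * A = N * C; y * D - D * y = C * N\<rbrakk>
      \<Longrightarrow> N = 0 \<and> (\<exists>z. central z \<and> x = z * P \<and> y = z * Q)"

locale principal_blocks = frobenius_blocks +
  fixes X Y N
  assumes X: "in_corner P P X" and Y: "in_corner Q Q Y" and N: "in_corner P Q N"
    and eqC: "C * X - Y * C = C"
    and eqA: "A * X - X * A - N * C = A"
    and eqD: "C * N + D * Y - Y * D = D"

context principal_blocks
begin

context
  fixes G
  assumes G: "in_corner P Q G" and GC: "G * C = P"
begin

text \<open>\<open>G\<close> is a left inverse of \<open>C\<close>, so \<open>C * G\<close> projects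
  W onto the image of C along the kernel of G; these two idempotents become the next
  \<open>P\<close> and \<open>Q\<close>.\<close>

abbreviation "P1 \<equiv> C * G"
abbreviation "Q1 \<equiv> Q - C * G"

lemma idem: 
  "G * P1 = G" "P1 * C = C" "G * Q1 = 0" "Q1 * C = 0" "P1 * P1 = P1" "Q1 * Q1 = Q1"
  "P1 * Q1 = 0" "Q1 * P1 = 0" "Q * P1 = P1" "P1 * Q = P1" "Q * Q1 = Q1" "Q1 * Q = Q1"
  "P * G = G" "G * Q = G" "Q * C = C" "C * P = C"
  using G GC C QQ unfolding in_corner_def
  by (simp_all add: algebra_simps mult_extend)

text \<open>By \<open>eqC\<close>, \<open>Y * C\<close> equals \<open>C * X - C\<close>, so Y maps
  the image of C into itself.\<close>

lemma Y_flag: "Q1 * Y * P1 = 0"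
proof -
  have "Y * C = C * X - C" using eqC by (simp add: algebra_simps)
  then have "Q1 * Y * P1 = Q1 * C * (X * G) - Q1 * C * G"
    by (metis mult.assoc right_diff_distrib left_diff_distrib)
  then show ?thesis by (simp only: idem) simp
qed

lemma Q1_Y: "Q1 * Y * Q1 = Q1 * Y" and Y_P1: "P1 * Y * P1 = Y * P1"
proof -
  have Y': "Q * Y = Y" "Y * Q = Y" using Y by (auto simp: in_corner_def)
  have "Q1 * Y * Q1 = Q1 * (Y * Q) - Q1 * Y * P1" by (simp add: algebra_simps)
  then show "Q1 * Y * Q1 = Q1 * Y" by (simp only: Y' Y_flag) simp
  have "Q1 * Y * P1 = Q * Y * P1 - P1 * Y * P1" by (simp add: algebra_simps)
  then show "P1 * Y * P1 = Y * P1" by (simp add: Y' Y_flag)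
qed


text \<open>
  The stabilizer of \<open>C\<close> in the Levi subalgebra is the parabolic subalgebra of \<open>End(W)\<close> that fixes
  the image of \<open>C\<close>, and the functional descends to it.
\<close>

lemma reduced_principal:
  "principal_blocks P1 Q1 (C * A * G + P1 * D * P1) (Q1 * D * P1) (Q1 * D * Q1)
     (P1 * Y * P1) (Q1 * Y * Q1) (P1 * Y * Q1)"
proof -
  \<comment> \<open>Origin of \<open>C * A * G\<close>: an element y that fixes the image of C
    determines \<open>x = G * y * C\<close> with \<open>C * x = y * C\<close>, and tr(A x) = tr(C A
    G y). The functional on End(W) is therefore given by \<open>C * A * G + D\<close>, whose first
    summand lies in the corner of \<open>C * G\<close>.\<close>
  define p where "p = P1"
  define q where "q = Q1"
  have base: "P * A = A" "A * P = A" "Q * D = D" "D * Q = D" "P * N = N" "N * Q = N"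
      "P * X = X" "X * P = X" "Q * Y = Y" "Y * Q = Y" "Q * C = C" "C * P = C" "P * P = P" "Q * Q = Q"
    using A D N X Y C PP QQ by (auto simp: in_corner_def)
  have pq: "G * p = G" "p * C = C" "G * q = 0" "q * C = 0" "p * p = p" "q * q = q"
    "p * q = 0" "q * p = 0" "Q * p = p" "p * Q = p" "Q * q = q" "q * Q = q"
    "P * G = G" "G * Q = G" "G * C = P" "C * G = p"
    unfolding p_def q_def by (rule idem GC refl)+
  have Yp: "p * (Y * p) = Y * p" "q * (Y * q) = q * Y" "q * (Y * p) = 0"
    using Y_P1 Q1_Y Y_flag unfolding p_def q_def by (simp_all only: mult.assoc)
  note ring = mult.assoc distrib_left distrib_right right_diff_distrib left_diff_distrib
  note rules = base pq base[THEN mult_extend] pq[THEN mult_extend] Yp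
    Yp[THEN mult_extend, unfolded mult.assoc]
  have eqC': "C * X = C + Y * C" and eqA': "A * X = A + X * A + N * C"
    and eqD': "D * Y = D + Y * D - C * N"
    using eqC eqA eqD by (simp_all add: algebra_simps)
  note eqs = eqC' eqA' eqD' eqC'[THEN mult_extend] eqA'[THEN mult_extend] eqD'[THEN mult_extend]
  have split: "x * (p * y) + x * (q * y) = x * y" if "x * Q = x" for x y
    unfolding p_def q_def by (simp add: ring that mult_extend[OF that])
  \<comment> \<open>On the image of C the weights of Y are those of X lowered by 1.\<close>
  have GYC: "G * (Y * C) = X - P"
    using arg_cong[OF eqC', of "\<lambda>t. G * t"] by (simp add: ring rules algebra_simps)
  have GY: "G * (Y * p) = X * G - G"
    using arg_cong[OF GYC, of "\<lambda>t. t * G"] by (simp add: ring rules)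
  have pYq: "p * (Y * (q * x)) = p * (Y * x) - Y * (p * x)" for x
  proof -
    have "Y * (q * x) = Y * x - Y * (p * x)" using split[of Y x] by (simp add: rules algebra_simps)
    then show ?thesis by (simp add: ring rules)
  qed
  \<comment> \<open>An element of the smaller stabilizer extends to one of the larger:
    \<open>v\<close> acts on W, \<open>G * x * C\<close> is the induced map on U, and
    \<open>m\<close> supplies the component in Hom(W,U).\<close>
  have stab: "n = 0 \<and> (\<exists>z. central z \<and> x = z * p \<and> y = z * q)"
    if x: "in_corner p p x" and y: "in_corner q q y" and n: "in_corner p q n"
      and c1: "q * D * p * x = y * (q * D * p)"
      and c2: "(C * A * G + p * D * p) * x - x * (C * A * G + p * D * p) = n * (q * D * p)"
      and c3: "y * (q * D * q) - q * D * q * y = q * D * p * n"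
    for x y n
  proof -
    have xyn: "p * x = x" "x * p = x" "q * y = y" "y * q = y" "p * n = n" "n * q = n"
      using x y n by (auto simp: in_corner_def)
    have xyn': "x * Q = x" "Q * x = x" "Q * y = y" "y * Q = y" "Q * n = n" "n * Q = n"
      "p * y = 0" "y * p = 0" "q * x = 0" "x * q = 0" "q * n = 0" "n * p = 0"
      "G * y = 0" "y * C = 0" "n * C = 0"
      using xyn pq by (metis mult.assoc mult_zero_left mult_zero_right)+
    note rs = ring rules xyn xyn' xyn[THEN mult_extend] xyn'[THEN mult_extend]
    define v where "v = x + y + n"
    define m where "m = G * (v * D - D * v)"
    \<comment> \<open>\<open>c1\<close> and \<open>c3\<close> are the two blocks of this identity.
      It says that \<open>v * D - D * v\<close> takes values in the image of C, hence has the form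
      \<open>C * m\<close>.\<close>
    have vq: "q * (v * D - D * v) = 0"
    proof -
      let ?t = "q * (v * D - D * v)"
      have "?t * p = 0"
        using c1 by (simp add: v_def rs)
      moreover have "?t * q = 0"
        using c3 by (simp add: v_def rs algebra_simps)
      moreover have "?t * (p * 1) + ?t * (q * 1) = ?t * 1"
        by (rule split) (simp add: v_def rs)
      ultimately show ?thesis by simp
    qed
    have Cm: "C * m = v * D - D * v"
    proof -
      have "C * m = p * (v * D - D * v)" by (simp add: m_def pq mult_extend[OF pq(16)])
      moreover have "1 * (p * (v * D - D * v)) + 1 * (q * (v * D - D * v)) = Q * (v * D - D * v)"
        unfolding p_def q_def by (simp add: algebra_simps)
      moreover have "Q * (v * D - D * v) = v * D - D * v" by (simp add: v_def rs)
      ultimately show ?thesis using vq by simp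
    qed
    have "m = 0 \<and> (\<exists>z. central z \<and> G * x * C = z * P \<and> v = z * Q)"
    proof (rule stabilizer)
      show "in_corner P P (G * x * C)" "in_corner Q Q v" "in_corner P Q m"
        by (simp_all add: in_corner_def v_def m_def rs)
      show "C * (G * x * C) = v * C" by (simp add: v_def rs)
      show "v * D - D * v = C * m" by (simp add: Cm)
      \<comment> \<open>Compressing \<open>c2\<close> by G and C carries it from the image of C back
        to U.\<close>
      have "G * ((C * A * G + p * D * p) * x - x * (C * A * G + p * D * p)) * C = G * (n * (q * D * p)) * C"
        by (simp only: c2)
      then show "A * (G * x * C) - G * x * C * A = m * C"
        by (simp add: m_def v_def rs algebra_simps)
    qed
    then obtain z where z: "central z" "G * x * C = z * P" "v = z * Q" by blast
    have zc: "r * z = z * r" for r using z by (simp add: central_def)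
    have zc': "r * (z * s) = z * (r * s)" for r s using zc by (metis mult.assoc)
    have "x = C * (G * x * C) * G" by (simp add: rs)
    also have "\<dots> = z * p" unfolding z by (simp add: ring zc' pq)
    finally have "x = z * p" .
    moreover have "n = p * v * q" by (simp add: v_def rs)
    then have "n = 0" unfolding z by (simp add: ring zc' pq)
    moreover have "y = q * v * q" by (simp add: v_def rs)
    then have "y = z * q" unfolding z by (simp add: ring zc' pq)
    ultimately show ?thesis using z by blast
  qed
  have "principal_blocks p q (C * A * G + p * D * p) (q * D * p) (q * D * q)
     (p * Y * p) (q * Y * q) (p * Y * q)"
  proof unfold_locales
    show "in_corner p p (C * A * G + p * D * p)" "in_corner q p (q * D * p)" "in_corner q q (q * D * q)"
      "in_corner p p (p * Y * p)" "in_corner q q (q * Y * q)" "in_corner p q (p * Y * q)"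
      by (simp_all add: in_corner_def ring rules)
    show "q * D * p * (p * Y * p) - q * Y * q * (q * D * p) = q * D * p"
      by (simp add: ring rules eqs)
    \<comment> \<open>The terms in N coming from \<open>eqA\<close> and from \<open>eqD\<close>
      cancel; what is left of the A part is \<open>(C * X - Y * C) * A * G\<close>, which is
      \<open>C * A * G\<close> by \<open>eqC\<close>.\<close>
    show "(C * A * G + p * D * p) * (p * Y * p) - p * Y * p * (C * A * G + p * D * p)
       - p * Y * q * (q * D * p) = C * A * G + p * D * p"
      by (simp add: ring rules eqs GY pYq algebra_simps)
    show "q * D * p * (p * Y * q) + q * D * q * (q * Y * q) - q * Y * q * (q * D * q) = q * D * q"
    proof -
      have "q * D * p * (p * Y * q) + q * D * q * (q * Y * q) = q * D * Y * q"
        using split[of "q * D" "Y * q"] by (simp add: ring rules)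
      then show ?thesis by (simp add: ring rules eqs)
    qed
  qed (use pq stab in \<open>simp_all only:\<close>)
  then show ?thesis unfolding p_def q_def .
qed

end
end

section \<open>Weight decompositions\<close>

text \<open>The spectral decomposition of X on the image of P: \<open>e k\<close> is the projection
  to the eigenvalue \<open>z + k\<close>. The offset z is kept because only weight differences are
  known to be integers.\<close>

definition weights :: "'r :: ring_1 \<Rightarrow> 'r \<Rightarrow> 'r \<Rightarrow> (int \<Rightarrow> 'r) \<Rightarrow> bool" where
  "weights z P X e \<longleftrightarrow> finite {k. e k \<noteq> 0} \<and> (\<forall>i j. e i * e j = (if i = j then e i else 0)) \<and>
     (\<Sum>k | e k \<noteq> 0. e k) = P \<and>
     (\<forall>k. X * e k = (z + of_int k) * e k \<and> e k * X = (z + of_int k) * e k)"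

lemma weights_sum:
  assumes "weights z P X e" "finite S" "{k. e k \<noteq> 0} \<subseteq> S"
  shows "sum e S = P"
proof -
  have "(\<Sum>k | e k \<noteq> 0. e k) = P" using assms(1) unfolding weights_def by blast
  moreover have "sum e S = (\<Sum>k | e k \<noteq> 0. e k)"
    by (rule sum.mono_neutral_right) (use assms(2,3) in auto)
  ultimately show ?thesis by metis
qed

lemma weights_corner:
  assumes "weights z P X e"
  shows "in_corner P P (e k)"
proof -
  let ?S = "{k. e k \<noteq> 0} \<union> {k}"
  have S: "finite ?S" using assms by (simp add: weights_def)
  have orth: "e i * e j = (if i = j then e i else 0)" for i j using assms by (simp add: weights_def)
  have P: "P = sum e ?S" by (rule weights_sum[OF assms S, symmetric]) auto
  show ?thesis
    unfolding in_corner_def P sum_distrib_left sum_distrib_right orth using S by simp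
qed

text \<open>The offset \<open>z\<close> is shared by U and W, so differences between weights of U
  and of W are integers too. The equation for N says that conjugation by \<open>1 - T\<close>
  carries X + Y to X + Y + N. Multiplicities are traces of the spectral projections.\<close>

definition weight_data :: "('r :: ring_1 \<Rightarrow> complex) \<Rightarrow> 'r \<Rightarrow> 'r \<Rightarrow> 'r \<Rightarrow> 'r \<Rightarrow> 'r \<Rightarrow>
    (int \<Rightarrow> nat) \<Rightarrow> (int \<Rightarrow> nat) \<Rightarrow> bool" where
  "weight_data tr P Q X Y N u w \<longleftrightarrow> (\<exists>z e f T. central z \<and> weights z P X e \<and> weights z Q Y f \<and>
     in_corner P Q T \<and> N = X * T - T * Y \<and>
     (\<forall>k. tr (e k) = of_nat (u k)) \<and> (\<forall>k. tr (f k) = of_nat (w k)))"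

lemma central_commute:
  assumes "central z"
  shows "r * ((z + of_int k) * s) = (z + of_int k) * (r * s)"
proof -
  have "r * (z + of_int k) = (z + of_int k) * r"
    using assms mult_of_int_commute[of k r] by (simp only: central_def distrib_left distrib_right)
  then show ?thesis by (metis mult.assoc)
qed

text \<open>
  The part of \<open>N\<close> of weight \<open>0\<close> lies in the stabilizer, hence vanishes; the other parts are
  commutators because \<open>i - j\<close> is invertible for \<open>i \<noteq> j\<close>.
\<close>

lemma coboundary:
  fixes P :: "'r :: real_algebra_1"
  assumes "principal_blocks P Q A C D X Y N"
    and z: "central z" and e: "weights z P X e" and f: "weights z Q Y f"
  obtains T where "in_corner P Q T" "N = X * T - T * Y"
proof -
  interpret principal_blocks P Q A C D X Y N by fact
  define S where "S = {k. e k \<noteq> 0} \<union> {k. f k \<noteq> 0}"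
  have S: "finite S" "sum e S = P" "sum f S = Q"
    using e f weights_sum[OF e, of S] weights_sum[OF f, of S] by (auto simp: S_def weights_def)
  have outside: "e k = 0" "f k = 0" if "k \<notin> S" for k
    using that by (auto simp: S_def)
  have ee: "e i * e j = (if i = j then e i else 0)" and ff: "f i * f j = (if i = j then f i else 0)" for i j
    using e f by (simp_all add: weights_def)
  have Xe: "X * e k = (z + of_int k) * e k" "e k * X = (z + of_int k) * e k"
    and Yf: "Y * f k = (z + of_int k) * f k" "f k * Y = (z + of_int k) * f k" for k
    using e f by (simp_all add: weights_def)
  have corner: "P * e k = e k" "e k * P = e k" "Q * f k = f k" "f k * Q = f k" for k
    using weights_corner[OF e] weights_corner[OF f] by (auto simp: in_corner_def)
  note zc' = central_commute[OF z]
  note ring = mult.assoc distrib_left distrib_right right_diff_distrib left_diff_distrib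
  have XeR: "r * (X * e k) = (z + of_int k) * (r * e k)" "e k * (X * r) = (z + of_int k) * (e k * r)" for r k
    by (simp only: Xe zc') (simp only: Xe mult.assoc[symmetric])
  have YfR: "r * (Y * f k) = (z + of_int k) * (r * f k)" "f k * (Y * r) = (z + of_int k) * (f k * r)" for r k
    by (simp only: Yf zc') (simp only: Yf mult.assoc[symmetric])
  have cancel: "(of_int k * x :: 'r) = 0 \<Longrightarrow> k \<noteq> 0 \<Longrightarrow> x = 0" for k x
    by (metis mult_eq_0_iff of_int_eq_0_iff scaleR_conv_of_real of_real_of_int_eq scaleR_eq_0_iff)
  \<comment> \<open>Compressing \<open>eqC\<close> by \<open>f j\<close> and \<open>e i\<close>
    multiplies the block of C by i - j, so only i = j + 1 survives: C lowers weights by 1.\<close>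
  have fCe: "f j * C * e i = 0" if "i \<noteq> j + 1" for i j
  proof -
    have "f j * (C * X - Y * C) * e i = f j * C * e i" by (simp only: eqC)
    moreover have "f j * (C * X - Y * C) * e i = f j * C * (X * e i) - f j * (Y * (C * e i))"
      by (simp only: ring)
    moreover have "\<dots> = (z + of_int i) * (f j * C * e i) - (z + of_int j) * (f j * C * e i)"
      by (simp only: XeR YfR mult.assoc)
    ultimately have "of_int (i - j - 1) * (f j * C * e i) = 0"
      by (simp add: algebra_simps)
    then show ?thesis using cancel that by (metis add.commute diff_add_cancel diff_diff_eq eq_iff_diff_eq_0)
  qed
  have Ce: "C * e i = f (i - 1) * C * e i" for i
  proof -
    have "C * e i = sum f S * C * e i" using S C by (simp add: in_corner_def)
    also have "\<dots> = (\<Sum>j\<in>S. if j = i - 1 then f (i - 1) * C * e i else 0)"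
      unfolding sum_distrib_right by (intro sum.cong) (use fCe in auto)
    also have "\<dots> = f (i - 1) * C * e i" using S outside by auto
    finally show ?thesis .
  qed
  have fC: "f j * C = f j * C * e (j + 1)" for j
  proof -
    have "f j * C = f j * C * sum e S" using S C by (simp add: in_corner_def mult.assoc)
    also have "\<dots> = (\<Sum>i\<in>S. if i = j + 1 then f j * C * e (j + 1) else 0)"
      unfolding sum_distrib_left by (intro sum.cong) (use fCe in auto)
    also have "\<dots> = f j * C * e (j + 1)" using S outside by auto
    finally show ?thesis .
  qed
  \<comment> \<open>The map \<open>\<lambda>t. X * t - t * Y\<close> acts on the block
    \<open>e i * N * f j\<close> by the factor i - j. \<open>N0\<close> collects the blocks with
    factor 0, and \<open>T\<close> divides the others by their factor.\<close>
  define N0 where "N0 = (\<Sum>i\<in>S. e i * N * f i)"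
  define T where "T = (\<Sum>i\<in>S. \<Sum>j\<in>S. if i = j then 0 else (1 / real_of_int (i - j)) *\<^sub>R (e i * N * f j))"
  have "C * N0 = (\<Sum>i\<in>S. C * e i * N * f i)" by (simp add: N0_def sum_distrib_left mult.assoc)
  also have "\<dots> = 0"
  proof (rule sum.neutral, rule ballI)
    \<comment> \<open>Between weights i - 1 and i the commutator \<open>D * Y - Y * D\<close> has
      the same block as D, so \<open>eqD\<close> forces the block of \<open>C * N\<close> to vanish.
      The argument for \<open>N0 * C\<close> uses \<open>eqA\<close> in the same way.\<close>
    fix i
    have "f (i - 1) * (C * N + D * Y - Y * D) * f i = f (i - 1) * D * f i" by (simp only: eqD)
    moreover have "f (i - 1) * (C * N + D * Y - Y * D) * f i =
        f (i - 1) * C * N * f i + f (i - 1) * D * (Y * f i) - f (i - 1) * (Y * (D * f i))"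
      by (simp only: ring)
    moreover have "\<dots> = f (i - 1) * C * N * f i + (z + of_int i) * (f (i - 1) * D * f i) - (z + of_int (i - 1)) * (f (i - 1) * D * f i)"
      by (simp only: YfR mult.assoc)
    ultimately have "f (i - 1) * C * N * f i = 0" by (simp add: algebra_simps)
    moreover have "C * e i = f (i - 1) * C" using Ce[of i] fC[of "i - 1"] by simp
    ultimately show "C * e i * N * f i = 0" by simp
  qed
  finally have CN0: "C * N0 = 0" .
  have "N0 * C = (\<Sum>i\<in>S. e i * N * (f i * C))" by (simp add: N0_def sum_distrib_right mult.assoc)
  also have "\<dots> = 0"
  proof (rule sum.neutral, rule ballI)
    fix i
    have "e i * (A * X - X * A - N * C) * e (i + 1) = e i * A * e (i + 1)" by (simp only: eqA)
    moreover have "e i * (A * X - X * A - N * C) * e (i + 1) =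
        e i * A * (X * e (i + 1)) - e i * (X * (A * e (i + 1))) - e i * N * (C * e (i + 1))"
      by (simp only: ring)
    moreover have "\<dots> = (z + of_int (i + 1)) * (e i * A * e (i + 1)) - (z + of_int i) * (e i * A * e (i + 1)) - e i * N * (C * e (i + 1))"
      by (simp only: XeR mult.assoc)
    ultimately have "e i * N * (C * e (i + 1)) = 0" by (simp add: algebra_simps)
    moreover have "C * e (i + 1) = f i * C" using Ce[of "i + 1"] fC[of i] by simp
    ultimately show "e i * N * (f i * C) = 0" by simp
  qed
  finally have N0C: "N0 * C = 0" .
  have N0: "in_corner P Q N0"
    by (simp add: in_corner_def N0_def sum_distrib_left sum_distrib_right mult.assoc corner
        mult_extend[OF corner(1)])
  have "N0 = 0"
    using stabilizer[of 0 0 N0] N0 CN0 N0C by (simp add: in_corner_def)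
  moreover have "X * T - T * Y + N0 = N"
  proof -
    have eNf: "X * (e i * N * f j) - (e i * N * f j) * Y = of_int (i - j) * (e i * N * f j)" for i j
    proof -
      have "X * (e i * N * f j) = (z + of_int i) * (e i * N * f j)"
        by (simp only: mult.assoc[symmetric] Xe)
      moreover have "(e i * N * f j) * Y = (z + of_int j) * (e i * N * f j)"
        by (simp only: mult.assoc Yf zc')
      ultimately show ?thesis by (simp add: algebra_simps)
    qed
    have scale: "(1 / real_of_int k) *\<^sub>R (of_int k * x :: 'r) = x" if "k \<noteq> 0" for k x
    proof -
      have "(of_int k * x :: 'r) = real_of_int k *\<^sub>R x"
        by (metis of_real_of_int_eq scaleR_conv_of_real)
      with that show ?thesis by simp
    qed
    have summand: "X * t - t * Y = (if i = j then 0 else e i * N * f j)"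
      if "t = (if i = j then 0 else (1 / real_of_int (i - j)) *\<^sub>R (e i * N * f j))" for i j t
      unfolding that using eNf[of i j] scale[of "i - j"] 
      by (auto simp: mult_scaleR_right simp flip: scaleR_right_diff_distrib)
    have "X * T - T * Y = (\<Sum>i\<in>S. \<Sum>j\<in>S. if i = j then 0 else e i * N * f j)"
      unfolding T_def sum_distrib_left sum_distrib_right sum_subtractf[symmetric]
      by (intro sum.cong refl summand)
    also have "\<dots> + N0 = (\<Sum>i\<in>S. \<Sum>j\<in>S. e i * N * f j)"
    proof -
      have "N0 = (\<Sum>i\<in>S. \<Sum>j\<in>S. if i = j then e i * N * f j else 0)"
        using S by (simp add: N0_def)
      then show ?thesis
        by (simp add: sum.distrib[symmetric]) (intro sum.cong, auto)
    qed
    also have "\<dots> = sum e S * N * sum f S"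
      by (simp add: sum_distrib_left sum_distrib_right) (rule sum.swap)
    also have "\<dots> = N" using S N by (simp add: in_corner_def)
    finally show ?thesis .
  qed
  moreover have "in_corner P Q T"
    unfolding in_corner_def T_def sum_distrib_left sum_distrib_right
    by (intro conjI sum.cong) (auto simp: mult.assoc corner mult_extend[OF corner(1)])
  ultimately show ?thesis using that by simp
qed


text \<open>Transport of spectral projections along an isomorphism S that intertwines X + m with Y.
  The lift uses m = 1 to pass from the image of C to U, and m = 0 for a unipotent change of
  complement.\<close>

lemma weights_conjugate:
  assumes e: "weights z P X e" and S: "S * S' = Q" and S': "S' * S = P"
    and S_corner: "in_corner Q P S" and S'_corner: "in_corner P Q S'"
    and X: "in_corner P P X" and Y: "in_corner Q Q Y" and z: "central z" and YS: "Y * S = S * (X + of_int m * P)"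
  shows "weights z Q Y (\<lambda>k. S * e (k - m) * S')"
proof -
  have corner: "P * e k = e k" "e k * P = e k" for k
    using weights_corner[OF e] by (auto simp: in_corner_def)
  have inj: "S * e k * S' = 0 \<longleftrightarrow> e k = 0" for k
  proof -
    have "S' * (S * e k * S') * S = e k" by (simp add: mult.assoc S' mult_extend[OF S'] corner)
    then show ?thesis by (metis mult_zero_left mult_zero_right)
  qed
  have ee: "e i * e j = (if i = j then e i else 0)" for i j
    using e unfolding weights_def by blast
  have Xe: "X * e k = (z + of_int k) * e k" "e k * X = (z + of_int k) * e k" for k
    using e unfolding weights_def by blast+
  have supp: "{k. S * e (k - m) * S' \<noteq> 0} = (\<lambda>k. k + m) ` {k. e k \<noteq> 0}"
    unfolding inj by (auto simp: image_iff) (metis diff_add_cancel)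
  have "finite {k. e k \<noteq> 0}" using e unfolding weights_def by blast
  then have fin: "finite {k. S * e (k - m) * S' \<noteq> 0}" by (simp only: supp finite_imageI)
  have total: "(\<Sum>k | S * e (k - m) * S' \<noteq> 0. S * e (k - m) * S') = Q"
  proof -
    have "(\<Sum>k | S * e (k - m) * S' \<noteq> 0. S * e (k - m) * S') = (\<Sum>k | e k \<noteq> 0. S * e k * S')"
      unfolding supp by (subst sum.reindex) (auto simp: inj_on_def)
    also have "\<dots> = S * (\<Sum>k | e k \<noteq> 0. e k) * S'"
      by (simp only: sum_distrib_left sum_distrib_right)
    also have "(\<Sum>k | e k \<noteq> 0. e k) = P" using e unfolding weights_def by blast
    finally show ?thesis using S S_corner by (simp add: in_corner_def)
  qed
  have orth: "S * e i * S' * (S * e j * S') = (if i = j then S * e i * S' else 0)" for i j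
  proof -
    have "S * e i * S' * (S * e j * S') = S * (e i * e j) * S'"
      by (simp add: mult.assoc mult_extend[OF S'] mult_extend[OF corner(1)] corner)
    then show ?thesis by (simp add: ee)
  qed
  note zc = central_commute[OF z]
  have XPe: "(X + of_int m * P) * e (k - m) = (z + of_int k) * e (k - m)"
    and eXP: "e (k - m) * (X + of_int m * P) = (z + of_int k) * e (k - m)" for k
  proof -
    have "e (k - m) * (of_int m * P) = of_int m * e (k - m)"
      by (metis mult.assoc mult_of_int_commute corner(2))
    then show "(X + of_int m * P) * e (k - m) = (z + of_int k) * e (k - m)"
      "e (k - m) * (X + of_int m * P) = (z + of_int k) * e (k - m)"
      by (simp_all add: distrib_left distrib_right mult.assoc Xe corner) (simp_all add: algebra_simps)
  qed
  have S'Y: "S' * Y = (X + of_int m * P) * S'"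
  proof -
    have "S' * Y = S' * (Y * S) * S'" using Y S by (simp add: in_corner_def mult.assoc)
    also have "\<dots> = P * (X + of_int m * P) * S'" by (simp add: YS mult_extend[OF S'] mult.assoc)
    also have "P * (X + of_int m * P) = X + of_int m * P"
    proof -
      have "P * P = P" using S' S'_corner by (metis in_corner_def mult.assoc)
      moreover have "P * (of_int m * P) = of_int m * (P * P)"
        by (metis mult.assoc mult_of_int_commute)
      ultimately show ?thesis using X by (simp add: in_corner_def distrib_left)
    qed
    finally show ?thesis .
  qed
  have "Y * (S * e (k - m) * S') = (z + of_int k) * (S * e (k - m) * S')" for k
  proof -
    have "Y * (S * e (k - m) * S') = S * ((X + of_int m * P) * e (k - m)) * S'"
      by (simp only: mult.assoc mult_extend[OF YS])
    then show ?thesis by (simp only: XPe mult.assoc zc)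
  qed
  moreover have "S * e (k - m) * S' * Y = (z + of_int k) * (S * e (k - m) * S')" for k
  proof -
    have "S * e (k - m) * S' * Y = S * (e (k - m) * (X + of_int m * P)) * S'"
      by (simp only: mult.assoc S'Y)
    then show ?thesis by (simp only: eXP mult.assoc zc)
  qed
  ultimately show ?thesis
    unfolding weights_def using fin total orth by simp
qed

lemma weights_add:
  assumes e: "weights z p X e" and f: "weights z q Y f"
    and X: "in_corner p p X" and Y: "in_corner q q Y" and pq: "p * q = 0" "q * p = 0"
  shows "weights z (p + q) (X + Y) (\<lambda>k. e k + f k)"
proof -
  have corner: "p * e k = e k" "e k * p = e k" "q * f k = f k" "f k * q = f k" for k
    using weights_corner[OF e] weights_corner[OF f] by (auto simp: in_corner_def)
  have XY: "X * p = X" "p * X = X" "q * Y = Y" "Y * q = Y"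
    using X Y by (auto simp: in_corner_def)
  have ortho: "x * p = x \<Longrightarrow> q * y = y \<Longrightarrow> x * y = 0" "x * q = x \<Longrightarrow> p * y = y \<Longrightarrow> x * y = 0" for x y
    using pq by (metis mult.assoc mult_zero_left mult_zero_right)+
  have zero: "e i * f j = 0" "f j * e i = 0" "X * f j = 0" "f j * X = 0" "Y * e i = 0" "e i * Y = 0" for i j
    using ortho corner XY by blast+
  have ee: "e i * e j = (if i = j then e i else 0)" "f i * f j = (if i = j then f i else 0)" for i j
    using e f unfolding weights_def by blast+
  have Xe: "X * e k = (z + of_int k) * e k" "e k * X = (z + of_int k) * e k"
     "Y * f k = (z + of_int k) * f k" "f k * Y = (z + of_int k) * f k" for k
    using e f unfolding weights_def by blast+
  let ?S = "{k. e k \<noteq> 0} \<union> {k. f k \<noteq> 0}"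
  have S: "finite ?S" using e f by (auto simp only: weights_def)
  have "(\<Sum>k | e k + f k \<noteq> 0. e k + f k) = (\<Sum>k\<in>?S. e k + f k)"
    using S by (intro sum.mono_neutral_left) auto
  also have "\<dots> = p + q"
    using weights_sum[OF e S] weights_sum[OF f S] by (simp add: sum.distrib)
  finally have "(\<Sum>k | e k + f k \<noteq> 0. e k + f k) = p + q" .
  moreover have "finite {k. e k + f k \<noteq> 0}"
    using S by (rule rev_finite_subset) auto
  moreover have "(e i + f i) * (e j + f j) = (if i = j then e i + f i else 0)" for i j
    by (simp add: distrib_left distrib_right zero ee)
  moreover have "(X + Y) * (e k + f k) = (z + of_int k) * (e k + f k)"
    "(e k + f k) * (X + Y) = (z + of_int k) * (e k + f k)" for k
    by (simp_all only: distrib_left distrib_right[of X] distrib_right[of "e k"] zero Xe) simp_all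
  ultimately show ?thesis unfolding weights_def by blast
qed

text \<open>C identifies U with its image and lowers weights by 1, so U carries the multiplicities
  of the image moved up by 1. W is an extension of the two smaller pieces and carries their
  sum.\<close>

lemma weight_data_lift:
  fixes P :: "'r :: real_algebra_1"
  assumes pb: "principal_blocks P Q A C D X Y N"
    and G: "in_corner P Q G" and GC: "G * C = P"
    and tr_add: "\<And>x y. tr (x + y) = tr x + tr y" and tr_commute: "\<And>x y. tr (x * y) = tr (y * x)"
    and red: "weight_data tr (C * G) (Q - C * G)
      (C * G * Y * (C * G)) ((Q - C * G) * Y * (Q - C * G)) (C * G * Y * (Q - C * G)) u w"
  shows "weight_data tr P Q X Y N (\<lambda>k. u (k - 1)) (\<lambda>k. u k + w k)"
proof -
  interpret principal_blocks P Q A C D X Y N by fact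
  define p where "p = C * G"
  define q where "q = Q - C * G"
  define X' Y' N' where "X' = p * Y * p" and "Y' = q * Y * q" and "N' = p * Y * q"
  note pq = idem[OF G GC, folded p_def q_def]
  note flag = Y_flag[OF G GC, folded p_def q_def] Y_P1[OF G GC, folded p_def q_def]
    Q1_Y[OF G GC, folded p_def q_def]
  obtain z e f T where z: "central z" and e: "weights z p X' e" and f: "weights z q Y' f"
    and T: "in_corner p q T" and N': "N' = X' * T - T * Y'"
    and tr_e: "\<And>k. tr (e k) = of_nat (u k)" and tr_f: "\<And>k. tr (f k) = of_nat (w k)"
    using red unfolding weight_data_def X'_def Y'_def N'_def p_def q_def by blast
  have X'c: "in_corner p p X'" and Y'c: "in_corner q q Y'" and N'c: "in_corner p q N'"
    using pq by (simp_all add: in_corner_def X'_def Y'_def N'_def mult.assoc pq[THEN mult_extend])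
  have e_corner: "p * e k = e k" "e k * p = e k" for k
    using weights_corner[OF e] by (auto simp: in_corner_def)
  have TT: "T * T = 0" "Q * T = T" "T * Q = T" "X' * q = 0" "T * X' = 0" "T * N' = 0" "Y' * T = 0" "N' * T = 0"
    using T X'c Y'c N'c pq unfolding in_corner_def by (metis mult.assoc mult_zero_left mult_zero_right)+
  have p_plus_q: "p + q = Q" by (simp add: p_def q_def)
  have Y_split: "Y = X' + Y' + N'"
  proof -
    have "Y = (p + q) * Y * (p + q)" using Y by (simp add: p_plus_q in_corner_def)
    also have "\<dots> = X' + Y' + N' + q * Y * p"
      by (simp only: distrib_left distrib_right X'_def Y'_def N'_def) (simp add: algebra_simps)
    finally show ?thesis by (simp add: flag)
  qed
  have "weights z P X (\<lambda>k. G * e (k - 1) * C)"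
  proof (rule weights_conjugate[OF e])
    show "G * C = P" "C * G = p" by (simp_all add: GC p_def)
    show "in_corner P p G" "in_corner p P C"
      using G C pq by (auto simp: in_corner_def)
    show "in_corner p p X'" "in_corner P P X" "central z" by (rule X'c X z)+
    have "G * (C * X - Y * C) * G = G * C * G" by (simp only: eqC)
    then have "X * G - G * Y * (C * G) = G"
      using X G by (simp add: right_diff_distrib left_diff_distrib mult.assoc mult_extend[OF GC] GC in_corner_def)
        (metis mult.assoc)
    then have "X * G = G * (Y * p) + G" by (simp add: p_def algebra_simps)
    moreover have "G * X' = G * (Y * p)" by (simp add: X'_def mult.assoc mult_extend[OF pq(1)])
    ultimately show "X * G = G * (X' + of_int 1 * p)" by (simp add: distrib_left pq)
  qed
  \<comment> \<open>Since \<open>T * T = 0\<close>, \<open>Q - T\<close> is invertible in its corner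
    with inverse \<open>Q + T\<close>, and it carries the split operator \<open>X' + Y'\<close> to
    Y. The index \<open>k - 0\<close> matches the shift m = 0.\<close>
  moreover have "weights z Q Y (\<lambda>k. (Q - T) * (e (k - 0) + f (k - 0)) * (Q + T))"
  proof (rule weights_conjugate)
    show "weights z Q (X' + Y') (\<lambda>k. e k + f k)"
      using weights_add[OF e f X'c Y'c] pq by (simp add: p_plus_q)
    show "(Q - T) * (Q + T) = Q" "(Q + T) * (Q - T) = Q" "in_corner Q Q (Q - T)" "in_corner Q Q (Q + T)"
      by (simp_all add: algebra_simps QQ TT in_corner_def)
    show "in_corner Q Q (X' + Y')" "in_corner Q Q Y" "central z"
      using X'c Y'c Y z pq unfolding in_corner_def distrib_left distrib_right by (metis mult.assoc)+
    have "x * Q = x" "Q * y = y" if "x * p = x \<or> x * q = x" "p * y = y \<or> q * y = y" for x y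
      using that pq by (metis mult.assoc)+
    then have "X' * Q = X'" "Y' * Q = Y'" "N' * Q = N'" "Q * X' = X'" "Q * Y' = Y'"
      using X'c Y'c N'c unfolding in_corner_def by blast+
    then show "Y * (Q - T) = (Q - T) * (X' + Y' + of_int 0 * Q)"
      unfolding Y_split
      by (simp add: right_diff_distrib left_diff_distrib distrib_left distrib_right TT) (simp add: N')
  qed
  \<comment> \<open>This comes last because solving for \<open>T'\<close> needs the spectral
    decompositions of both X and Y.\<close>
  moreover obtain T' where "in_corner P Q T'" "N = X * T' - T' * Y"
    using coboundary[OF pb z] calculation by blast
  moreover have "tr (G * e (k - 1) * C) = of_nat (u (k - 1))" for k
    using tr_e[of "k - 1"] tr_commute[of G "e (k - 1) * C"]
    by (simp add: mult.assoc flip: p_def) (simp add: e_corner)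
  moreover have "tr ((Q - T) * (e (k - 0) + f (k - 0)) * (Q + T)) = of_nat (u k + w k)" for k
  proof -
    have "(Q + T) * (Q - T) = Q" by (simp add: algebra_simps QQ TT)
    moreover have "(e k + f k) * Q = e k + f k"
      using weights_corner[OF weights_add[OF e f X'c Y'c], of k] pq by (simp add: p_plus_q in_corner_def)
    ultimately show ?thesis
      using tr_e[of k] tr_f[of k] tr_commute[of "Q - T" "(e k + f k) * (Q + T)"]
      by (simp add: mult.assoc tr_add)
  qed
  ultimately show ?thesis
    using z unfolding weight_data_def by blast
qed

section \<open>The ring of square matrices\<close>

text \<open>Von Neumann regularity: G is a linear right inverse of M on its range.\<close>

lemma matrix_regular:
  fixes M :: "complex^'n^'m"
  obtains G where "M ** G ** M = M"
proof -
  obtain g where g: "Vector_Spaces.linear (*s) (*s) g" "\<forall>v\<in>range ((*v) M). M *v g v = v"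
    using vec.linear_exists_right_inverse_on[OF matrix_vector_mul_linear_gen[of M] vec.subspace_UNIV] by blast
  then have "M ** matrix g ** M = M"
    by (simp add: matrix_eq matrix_works flip: matrix_vector_mul_assoc)
  with that show ?thesis by blast
qed

text \<open>Rank factorization: B is a basis of the image, and \<open>q\<close> reads off
  coordinates after applying e. Biorthogonality holds because e fixes its image.\<close>

lemma idempotent_matrix_factorization:
  fixes e :: "complex^'n^'n"
  assumes "e ** e = e"
  obtains B :: "(complex^'n) set" and q where "finite B"
    "\<And>i j. e $ i $ j = (\<Sum>b\<in>B. b $ i * q b $ j)"
    "\<And>b c. b \<in> B \<Longrightarrow> c \<in> B \<Longrightarrow> (\<Sum>j\<in>UNIV. q b $ j * c $ j) = of_bool (b = c)"
proof -
  let ?V = "range ((*v) e)"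
  obtain B where B: "B \<subseteq> ?V" "vec.independent B" "?V \<subseteq> vec.span B"
    by (rule vec.basis_exists[of ?V])
  have fin: "finite B" using B vec.finiteI_independent by blast
  define r where "r b v = vec.representation B (e *v v) b" for b v
  have span: "e *v v \<in> vec.span B" for v using B by blast
  have r_sum: "r b (\<Sum>j\<in>J. c j *s f j) = (\<Sum>j\<in>J. c j * r b (f j))" for b J c and f :: "'n \<Rightarrow> complex^'n"
  proof (induction J rule: infinite_finite_induct)
    case (insert x F)
    then show ?case
      using B span by (simp add: r_def vec.add vec.scale vec.representation_add vec.representation_scale vec.span_scale)
  qed (simp_all add: r_def vec.representation_zero)
  have expand: "v = (\<Sum>j\<in>UNIV. v $ j *s axis j 1)" for v :: "complex^'n"
    by (simp add: vec_eq_iff axis_def if_distrib cong: if_cong)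
  define q where "q b = (\<chi> j. r b (axis j 1))" for b
  have q: "(\<Sum>j\<in>UNIV. q b $ j * v $ j) = r b v" for b v
    by (subst (2) expand) (simp add: r_sum q_def mult.commute)
  show ?thesis
  proof
    show "finite B" by (rule fin)
    show "e $ i $ j = (\<Sum>b\<in>B. b $ i * q b $ j)" for i j
    proof -
      have "(\<Sum>b\<in>B. r b (axis j 1) *s b) = e *v axis j 1"
        unfolding r_def by (rule vec.sum_representation_eq) (use B fin span in auto)
      then have "(\<Sum>b\<in>B. r b (axis j 1) *s b) $ i = (e *v axis j 1) $ i" by simp
      then show ?thesis
        by (simp add: q_def mult.commute matrix_vector_mult_def axis_def if_distrib cong: if_cong)
    qed
    fix b c assume bc: "b \<in> B" "c \<in> B"
    then obtain v where "c = e *v v" using B by blast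
    then have "e *v c = c" using assms by (simp add: matrix_vector_mul_assoc)
    then show "(\<Sum>j\<in>UNIV. q b $ j * c $ j) = of_bool (b = c)"
      using bc B by (simp add: q r_def vec.representation_basis)
  qed
qed

text \<open>
  A copy of the type of square matrices, because the ring structure on \<open>complex^'n^'n\<close> is the
  componentwise one.
\<close>

typedef 'n sqmat = "UNIV :: (complex^'n^'n) set" morphisms to_matrix of_matrix ..

setup_lifting type_definition_sqmat

text \<open>Real scaling suffices for the descent, whose only divisions are by non-zero integer
  weight differences; complex scalars enter later as central elements.\<close>

instantiation sqmat :: (finite) real_algebra_1
begin

lift_definition zero_sqmat :: "'a sqmat" is 0 .
lift_definition one_sqmat :: "'a sqmat" is "mat 1" .
lift_definition plus_sqmat :: "'a sqmat \<Rightarrow> 'a sqmat \<Rightarrow> 'a sqmat" is "(+)" .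
lift_definition minus_sqmat :: "'a sqmat \<Rightarrow> 'a sqmat \<Rightarrow> 'a sqmat" is "(-)" .
lift_definition uminus_sqmat :: "'a sqmat \<Rightarrow> 'a sqmat" is uminus .
lift_definition times_sqmat :: "'a sqmat \<Rightarrow> 'a sqmat \<Rightarrow> 'a sqmat" is "(**)" .
lift_definition scaleR_sqmat :: "real \<Rightarrow> 'a sqmat \<Rightarrow> 'a sqmat" is "(*\<^sub>R)" .

instance
proof
  fix a b c :: "'a sqmat" and r s :: real
  show "a + b + c = a + (b + c)" "a + b = b + a" "0 + a = a" "- a + a = 0" "a - b = a + - b"
    "r *\<^sub>R (a + b) = r *\<^sub>R a + r *\<^sub>R b" "(r + s) *\<^sub>R a = r *\<^sub>R a + s *\<^sub>R a"
    "r *\<^sub>R s *\<^sub>R a = (r * s) *\<^sub>R a" "1 *\<^sub>R a = a"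
    by (transfer, simp add: scaleR_add_right scaleR_add_left)+
  show "a * b * c = a * (b * c)" "1 * a = a" "a * 1 = a"
    by (transfer, simp add: matrix_mul_assoc)+
  show "(a + b) * c = a * c + b * c" "a * (b + c) = a * b + a * c"
    by (transfer, simp add: matrix_matrix_mult_def vec_eq_iff distrib_left distrib_right sum.distrib)+
  show "r *\<^sub>R a * b = r *\<^sub>R (a * b)" "a * r *\<^sub>R b = r *\<^sub>R (a * b)"
    by (transfer, simp add: matrix_matrix_mult_def vec_eq_iff scaleR_sum_right)+
  show "(0 :: 'a sqmat) \<noteq> 1" by transfer (auto simp: mat_def vec_eq_iff)
qed

end

lift_definition sq_trace :: "'n::finite sqmat \<Rightarrow> complex" is trace .
lift_definition sq_transpose :: "'n::finite sqmat \<Rightarrow> 'n sqmat" is transpose .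

lemma sq_trace_add: "sq_trace (x + y) = sq_trace x + sq_trace y"
  by transfer (rule trace_add)

lemma sq_trace_commute: "sq_trace (x * y) = sq_trace (y * x)"
  by transfer (rule trace_mul_sym)

lemma sq_transpose_simps [simp]:
  "sq_transpose (x * y) = sq_transpose y * sq_transpose x"
  "sq_transpose (x + y) = sq_transpose x + sq_transpose y"
  "sq_transpose (x - y) = sq_transpose x - sq_transpose y"
  "sq_transpose (- x) = - sq_transpose x"
  "sq_transpose 0 = 0" "sq_transpose 1 = 1"
  "sq_transpose (sq_transpose x) = x"
  "sq_trace (sq_transpose x) = sq_trace x"
proof -
  show "sq_transpose (x * y) = sq_transpose y * sq_transpose x" by transfer (rule matrix_transpose_mul)
  show "sq_transpose 1 = 1" by transfer (rule transpose_mat)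
  show "sq_trace (sq_transpose x) = sq_trace x" by transfer (simp add: trace_def transpose_def)
qed (transfer, simp add: transpose_def vec_eq_iff)+

lemma sq_regular:
  obtains G where "M * G * M = (M :: 'n::finite sqmat)"
proof -
  have "\<exists>G. M * G * M = M"
    by transfer (metis matrix_regular)
  with that show ?thesis by blast
qed

text \<open>Primeness of the ring: a matrix unit joining a non-zero entry of e to one of f will do.
  It supplies the non-zero map from the cokernel of C to its kernel.\<close>

lemma sq_prime:
  fixes e f :: "'n::finite sqmat"
  assumes "e \<noteq> 0" "f \<noteq> 0"
  obtains z where "e * z * f \<noteq> 0"
proof -
  have "\<exists>z. e * z * f \<noteq> 0" using assms
  proof transfer
    fix e f :: "complex^'n^'n" assume "e \<noteq> 0" "f \<noteq> 0"
    then obtain i j k l where "e $ i $ j \<noteq> 0" "f $ k $ l \<noteq> 0" by (auto simp: vec_eq_iff)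
    moreover have "(e ** (\<chi> a b. if a = j \<and> b = k then 1 else 0) ** f) $ i $ l = e $ i $ j * f $ k $ l"
    proof -
      have "(e ** (\<chi> a b. if a = j \<and> b = k then 1 else 0)) $ i $ m = (if m = k then e $ i $ j else 0)" for m
        by (cases "m = k") (simp_all add: matrix_matrix_mult_def if_distrib cong: if_cong)
      then show ?thesis
        by (subst matrix_matrix_mult_def) (simp add: if_distrib[of "\<lambda>x. x * _"] cong: if_cong)
    qed
    ultimately show "\<exists>z. e ** z ** f \<noteq> 0" by (metis mult_eq_0_iff zero_index)
  qed
  with that show ?thesis by blast
qed

text \<open>Here n is the rank. The corner of an idempotent of rank n is a full matrix ring of size
  n, commutative only for n at most 1; that clause is what identifies the end of the descent as
  gl_1.\<close>

lemma sq_trace_idempotent: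
  fixes e :: "'n::finite sqmat"
  assumes "e * e = e"
  obtains n where "sq_trace e = of_nat n" "n = 0 \<longleftrightarrow> e = 0"
    "(\<And>x y. in_corner e e x \<Longrightarrow> in_corner e e y \<Longrightarrow> x * y = y * x) \<Longrightarrow> n \<le> 1"
proof -
  have "\<exists>n. sq_trace e = of_nat n \<and> (n = 0 \<longleftrightarrow> e = 0) \<and>
    ((\<forall>x y. e * x = x \<longrightarrow> x * e = x \<longrightarrow> e * y = y \<longrightarrow> y * e = y \<longrightarrow> x * y = y * x) \<longrightarrow> n \<le> 1)"
    using assms
  proof transfer
    fix e :: "complex^'n^'n" assume e: "e ** e = e"
    then obtain B q where B: "finite B"
      "\<And>i j. e $ i $ j = (\<Sum>b\<in>B. b $ i * q b $ j)"
      "\<And>b c. b \<in> B \<Longrightarrow> c \<in> B \<Longrightarrow> (\<Sum>j\<in>UNIV. q b $ j * c $ j) = of_bool (b = c)"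
      using idempotent_matrix_factorization by blast
    \<comment> \<open>For b and c in B these lie in the corner of e and multiply like matrix
      units.\<close>
    define outer where "outer b c = (\<chi> i j. b $ i * q c $ j)" for b c :: "complex^'n"
    have outer_mult: "outer a b ** outer c d = (if b = c then outer a d else 0)"
      if "b \<in> B" "c \<in> B" for a b c d
    proof -
      have "(outer a b ** outer c d) $ i $ j = a $ i * (\<Sum>k\<in>UNIV. q b $ k * c $ k) * q d $ j" for i j
        by (simp add: matrix_matrix_mult_def outer_def sum_distrib_left sum_distrib_right mult_ac)
      then show ?thesis using B(3)[OF that] by (simp add: vec_eq_iff outer_def)
    qed
    have outer_nz: "outer b b \<noteq> 0" if "b \<in> B" for b
    proof
      assume "outer b b = 0"
      then have "b $ i * q b $ i = 0" for i by (auto simp: outer_def vec_eq_iff)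
      then have "(\<Sum>i\<in>UNIV. q b $ i * b $ i) = 0" by (intro sum.neutral) (simp add: mult.commute)
      then show False using B(3)[OF that that] by simp
    qed
    have e_sum: "e = (\<Sum>b\<in>B. outer b b)"
      by (simp add: vec_eq_iff B(2) outer_def)
    have trace_sum: "trace e = of_nat (card B)"
    proof -
      have "trace e = (\<Sum>b\<in>B. \<Sum>i\<in>UNIV. q b $ i * b $ i)"
        unfolding trace_def B(2) by (subst sum.swap) (simp add: mult.commute)
      also have "\<dots> = of_nat (card B)" by (simp add: B(3))
      finally show ?thesis .
    qed
    have e_outer: "e ** outer b c = outer b c" "outer c b ** e = outer c b" if "b \<in> B" "c \<in> B" for b c
    proof -
      have "(e ** outer b c) $ i $ j = outer b c $ i $ j" for i j
      proof -
        have "(e ** outer b c) $ i $ j = (\<Sum>a\<in>B. a $ i * (\<Sum>k\<in>UNIV. q a $ k * b $ k) * q c $ j)"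
          unfolding matrix_matrix_mult_def outer_def vec_lambda_beta B(2) sum_distrib_left sum_distrib_right
          by (subst sum.swap) (simp add: mult_ac)
        also have "\<dots> = (\<Sum>a\<in>B. if a = b then b $ i * q c $ j else 0)"
          by (intro sum.cong) (use that B(3) in auto)
        finally show ?thesis using that B(1) by (simp add: outer_def)
      qed
      then show "e ** outer b c = outer b c" by (simp add: vec_eq_iff)
      have "(outer c b ** e) $ i $ j = outer c b $ i $ j" for i j
      proof -
        have "(outer c b ** e) $ i $ j = (\<Sum>a\<in>B. c $ i * (\<Sum>k\<in>UNIV. q b $ k * a $ k) * q a $ j)"
          unfolding matrix_matrix_mult_def outer_def vec_lambda_beta B(2) sum_distrib_left sum_distrib_right
          by (subst sum.swap) (simp add: mult_ac)
        also have "\<dots> = (\<Sum>a\<in>B. if a = b then c $ i * q b $ j else 0)"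
          by (intro sum.cong) (use that B(3) in auto)
        finally show ?thesis using that B(1) by (simp add: outer_def)
      qed
      then show "outer c b ** e = outer c b" by (simp add: vec_eq_iff)
    qed
    have "e = 0" if "B = {}" using that e_sum by simp
    moreover have "B = {}" if "e = 0"
    proof (rule ccontr)
      assume "B \<noteq> {}"
      then obtain b where b: "b \<in> B" by blast
      have "0 ** outer b b = 0" by (simp add: matrix_matrix_mult_def vec_eq_iff)
      then show False using e_outer(1)[OF b b] outer_nz[OF b] that by simp
    qed
    moreover have "card B \<le> 1"
      if comm: "\<forall>x y. e ** x = x \<longrightarrow> x ** e = x \<longrightarrow> e ** y = y \<longrightarrow> y ** e = y \<longrightarrow> x ** y = y ** x"
    proof (rule card_le_Suc0_iff_eq[OF B(1), THEN iffD2, folded One_nat_def], intro ballI, rule ccontr)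
      fix b c assume bc: "b \<in> B" "c \<in> B" "b \<noteq> c"
      have "outer b c ** outer c b = outer c b ** outer b c"
        using comm e_outer bc by blast
      then have eq: "outer b b = outer c c" using bc by (simp add: outer_mult)
      have "outer b b ** outer b b = outer b b ** outer c c" by (simp only: eq)
      then show False using bc outer_nz by (simp add: outer_mult)
    qed
    ultimately show "\<exists>n. trace e = of_nat n \<and> (n = 0 \<longleftrightarrow> e = 0) \<and>
      ((\<forall>x y. e ** x = x \<longrightarrow> x ** e = x \<longrightarrow> e ** y = y \<longrightarrow> y ** e = y \<longrightarrow> x ** y = y ** x) \<longrightarrow> n \<le> 1)"
      using trace_sum B(1) by (intro exI[of _ "card B"]) auto
  qed
  with that show ?thesis unfolding in_corner_def by blast
qed

section \<open>Duality by transposition\<close>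

lemma in_corner_transpose [simp]:
  "in_corner (sq_transpose e) (sq_transpose f) (sq_transpose x) \<longleftrightarrow> in_corner f e x"
proof -
  have inj: "sq_transpose a = sq_transpose b \<longleftrightarrow> a = b" for a b :: "'a sqmat"
    by (metis sq_transpose_simps(7))
  show ?thesis
    unfolding in_corner_def by (metis inj sq_transpose_simps(1))
qed

lemma in_corner_transpose_swap:
  "in_corner (sq_transpose e) (sq_transpose f) x \<longleftrightarrow> in_corner f e (sq_transpose x)"
  using in_corner_transpose[of e f "sq_transpose x"] by simp

lemma in_corner_minus [simp]: "in_corner e f (- x) \<longleftrightarrow> in_corner e f x"
  by (simp add: in_corner_def)

lemma central_transpose: "central z \<Longrightarrow> central (sq_transpose z)"
  unfolding central_def by (metis sq_transpose_simps(1,7))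

text \<open>The annihilator of U in the dual space is dual to W, so P and Q, and likewise A and D,
  exchange roles. A Lie algebra element acts on the dual by minus its transpose, hence the signs on
  X, Y and N only.\<close>

lemma principal_blocks_transpose:
  fixes P :: "'n::finite sqmat"
  assumes "principal_blocks P Q A C D X Y N"
  shows "principal_blocks (sq_transpose Q) (sq_transpose P) (sq_transpose D) (sq_transpose C)
    (sq_transpose A) (- sq_transpose Y) (- sq_transpose X) (- sq_transpose N)"
proof -
  interpret principal_blocks P Q A C D X Y N by fact
  let ?t = "sq_transpose :: 'n sqmat \<Rightarrow> 'n sqmat"
  have stab: "n = 0 \<and> (\<exists>z. central z \<and> x = z * ?t Q \<and> y = z * ?t P)"
    if xyn: "in_corner (?t Q) (?t Q) x" "in_corner (?t P) (?t P) y" "in_corner (?t Q) (?t P) n"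
      and eqs: "?t C * x = y * ?t C" "?t D * x - x * ?t D = n * ?t C" "y * ?t A - ?t A * y = ?t C * n"
    for x y n
  proof -
    have "?t n = 0 \<and> (\<exists>z. central z \<and> ?t y = z * P \<and> ?t x = z * Q)"
    proof (rule stabilizer)
      show "in_corner P P (?t y)" "in_corner Q Q (?t x)" "in_corner P Q (?t n)"
        using xyn by (simp_all add: in_corner_transpose_swap)
      show "C * ?t y = ?t x * C" "A * ?t y - ?t y * A = ?t n * C" "?t x * D - D * ?t x = C * ?t n"
        using eqs[THEN arg_cong[of _ _ ?t]] by simp_all
    qed
    then obtain z where z: "?t n = 0" "central z" "?t y = z * P" "?t x = z * Q" by blast
    have "n = 0" using z by (metis sq_transpose_simps(5,7))
    moreover have "x = ?t z * ?t Q" "y = ?t z * ?t P"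
      using z by (metis sq_transpose_simps(1,7) central_def)+
    ultimately show ?thesis using central_transpose z by blast
  qed
  show ?thesis
  proof unfold_locales
    show "?t C * - ?t Y - - ?t X * ?t C = ?t C"
      using arg_cong[OF eqC, of ?t] by simp
    show "?t D * - ?t Y - - ?t Y * ?t D - - ?t N * ?t C = ?t D"
      using arg_cong[OF eqD, of ?t] by (simp add: algebra_simps)
    show "?t C * - ?t N + ?t A * - ?t X - - ?t X * ?t A = ?t A"
      using arg_cong[OF eqA, of ?t] by (simp add: algebra_simps)
  qed (use PP QQ PQ QP A C D X Y N stab in \<open>simp_all flip: sq_transpose_simps(1)\<close>)
qed

text \<open>An eigenvalue z + k of X becomes -z - k for minus the transpose, whence the new offset
  and the reversed index.\<close>

lemma weights_transpose:
  fixes P :: "'n::finite sqmat"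
  assumes z: "central z" and e: "weights z P X e"
  shows "weights (- sq_transpose z) (sq_transpose P) (- sq_transpose X) (\<lambda>k. sq_transpose (e (- k)))"
proof -
  let ?t = "sq_transpose :: 'n sqmat \<Rightarrow> 'n sqmat"
  have zero: "?t x = 0 \<longleftrightarrow> x = 0" for x by (metis sq_transpose_simps(5,7))
  have supp: "{k. ?t (e (- k)) \<noteq> 0} = uminus ` {k. e k \<noteq> 0}"
    unfolding zero by (auto simp: image_iff) (metis minus_minus)
  have t_sum: "?t (sum g S) = (\<Sum>k\<in>S. ?t (g k))" for g and S :: "int set"
    by (induction S rule: infinite_finite_induct) auto
  have of_int_t: "?t (of_int k) = of_int k" for k
  proof -
    have "?t (of_nat n) = of_nat n" for n by (induction n) simp_all
    then show ?thesis by (cases k rule: int_cases2) simp_all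
  qed
  have "finite {k. e k \<noteq> 0}" "(\<Sum>k | e k \<noteq> 0. e k) = P" using e unfolding weights_def by blast+
  then have "finite {k. ?t (e (- k)) \<noteq> 0}" "(\<Sum>k | ?t (e (- k)) \<noteq> 0. ?t (e (- k))) = ?t P"
    unfolding supp by (simp_all add: sum.reindex inj_on_def flip: t_sum)
  moreover have "e i * e j = (if i = j then e i else 0)" for i j using e unfolding weights_def by blast
  then have "?t (e (- i)) * ?t (e (- j)) = (if i = j then ?t (e (- i)) else 0)" for i j
    by (simp flip: sq_transpose_simps(1))
  moreover have Xe: "X * e k = (z + of_int k) * e k" "e k * X = (z + of_int k) * e k" for k
    using e unfolding weights_def by blast+
  have "- ?t X * ?t (e (- k)) = (- ?t z + of_int k) * ?t (e (- k))" (is ?A)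
    and "?t (e (- k)) * - ?t X = (- ?t z + of_int k) * ?t (e (- k))" (is ?B) for k
  proof -
    have "(z + of_int (- k)) * e (- k) = e (- k) * (z + of_int (- k))"
      using z central_commute[OF z, of "e (- k)" "- k" 1] by simp
    then have "?t ((z + of_int (- k)) * e (- k)) = (?t z - of_int k) * ?t (e (- k))"
      by (simp add: of_int_t)
    then have "?t (X * e (- k)) = (?t z - of_int k) * ?t (e (- k))"
      "?t (e (- k) * X) = (?t z - of_int k) * ?t (e (- k))"
      by (simp_all only: Xe)
    then show ?A ?B by (simp_all add: algebra_simps)
  qed
  ultimately show ?thesis unfolding weights_def by blast
qed

lemma weight_data_transpose:
  fixes P :: "'n::finite sqmat"
  assumes "weight_data sq_trace (sq_transpose Q) (sq_transpose P)
     (- sq_transpose Y) (- sq_transpose X) (- sq_transpose N) u w"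
  shows "weight_data sq_trace P Q X Y N (\<lambda>k. w (- k)) (\<lambda>k. u (- k))"
proof -
  let ?t = "sq_transpose :: 'n sqmat \<Rightarrow> 'n sqmat"
  obtain z e f T where z: "central z" and e: "weights z (?t Q) (- ?t Y) e"
    and f: "weights z (?t P) (- ?t X) f" and T: "in_corner (?t Q) (?t P) T"
    and N: "- ?t N = - ?t Y * T - T * - ?t X"
    and tr: "\<And>k. sq_trace (e k) = of_nat (u k)" "\<And>k. sq_trace (f k) = of_nat (w k)"
    using assms unfolding weight_data_def by blast
  have "weights (- ?t z) P X (\<lambda>k. ?t (f (- k)))" "weights (- ?t z) Q Y (\<lambda>k. ?t (e (- k)))"
    using weights_transpose[OF z e] weights_transpose[OF z f] by simp_all
  moreover have "central (- ?t z)"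
    using central_transpose[OF z] by (simp add: central_def)
  moreover have "in_corner P Q (- ?t T)"
    using T by (simp add: in_corner_transpose_swap)
  moreover have "N = X * - ?t T - - ?t T * Y"
    using arg_cong[OF N, of "\<lambda>x. - ?t x"] by (simp add: algebra_simps)
  ultimately show ?thesis
    unfolding weight_data_def using tr by (intro exI conjI) (assumption | simp)+
qed

section \<open>End of the descent and induction\<close>

lemma weight_data_base:
  fixes P :: "'n::finite sqmat"
  assumes "principal_blocks P Q A C D X Y N" and Q: "Q = 0" and P: "P \<noteq> 0"
  shows "weight_data sq_trace P Q X Y N (\<lambda>k. if k = 0 then 1 else 0) (\<lambda>k. 0)"
proof -
  interpret principal_blocks P Q A C D X Y N by fact
  have zero: "C = 0" "D = 0" "Y = 0" "N = 0"
    using C D Y N by (auto simp: in_corner_def Q)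
  \<comment> \<open>With Q = 0 the stabilizer condition says that whatever commutes with A is
    scalar. A commutes with itself, so A is scalar, so everything in the corner is scalar and the
    corner has rank 1.\<close>
  obtain z where z: "central z" "A = z * P"
    using stabilizer[of A 0 0] A zero by (auto simp: in_corner_def)
  have scalar: "\<exists>z. central z \<and> x = z * P" if x: "in_corner P P x" for x
  proof -
    have "A * x = x * A"
      using x z unfolding in_corner_def central_def by (metis mult.assoc)
    then show ?thesis using stabilizer[of x 0 0] x zero by (auto simp: in_corner_def)
  qed
  obtain c where c: "central c" "X = c * P" using scalar X by blast
  obtain n where n: "sq_trace P = of_nat n" "n = 0 \<longleftrightarrow> P = 0"
    "(\<And>x y. in_corner P P x \<Longrightarrow> in_corner P P y \<Longrightarrow> x * y = y * x) \<Longrightarrow> n \<le> 1"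
    using sq_trace_idempotent[OF PP] by blast
  have "x * y = y * x" if "in_corner P P x" "in_corner P P y" for x y
    using scalar[OF that(1)] that(2) unfolding in_corner_def central_def by (metis mult.assoc)
  then have "n = 1" using n P by fastforce
  moreover have "weights c P X (\<lambda>k. if k = 0 then P else 0)"
    using P PP c by (auto simp: weights_def mult.assoc if_distrib central_def mult_extend[OF PP] cong: if_cong)
  moreover have "weights c Q Y (\<lambda>k. 0)"
    by (simp add: weights_def Q)
  moreover have "sq_trace (0 :: 'n sqmat) = 0"
    using sq_trace_add[of 0 "0 :: 'n sqmat"] by simp
  ultimately show ?thesis
    unfolding weight_data_def using c n zero
    by (intro exI[of _ c] exI[of _ "\<lambda>k. if k = 0 then P else 0"] exI[of _ "\<lambda>k. 0"] exI[of _ 0])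
      (simp add: in_corner_def)
qed

text \<open>
  If \<open>C\<close> had neither a left nor a right inverse, then \<open>ker C\<close> and \<open>coker C\<close> would be non-zero,
  and a non-zero map \<open>coker C \<rightarrow> ker C\<close> would lie in the stabilizer.
\<close>

lemma (in frobenius_blocks) one_sided_inverse:
  assumes "C * G * C = C" "in_corner P Q G"
    and prime: "P - G * C \<noteq> 0 \<Longrightarrow> Q - C * G \<noteq> 0 \<Longrightarrow> \<exists>z. (P - G * C) * z * (Q - C * G) \<noteq> 0"
  shows "G * C = P \<or> C * G = Q"
proof (rule ccontr)
  assume "\<not> ?thesis"
  then obtain z where z: "(P - G * C) * z * (Q - C * G) \<noteq> 0"
    using prime by auto
  let ?n = "(P - G * C) * z * (Q - C * G)"
  have CP: "C * P = C" "Q * C = C" "P * G = G" "G * Q = G" using C assms by (auto simp: in_corner_def)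
  have "(Q - C * G) * C = 0" "C * (P - G * C) = 0"
    using assms(1) CP by (simp_all add: left_diff_distrib right_diff_distrib mult.assoc)
  then have "?n * C = 0" "C * ?n = 0"
    by (simp_all only: mult.assoc mult_zero_right) (simp flip: mult.assoc)
  moreover have "in_corner P Q ?n"
    unfolding in_corner_def using PP QQ CP
    by (simp add: left_diff_distrib right_diff_distrib mult.assoc mult_extend[OF PP] mult_extend[OF CP(3)])
  ultimately have "?n = 0"
    using stabilizer[of 0 0 ?n] by (simp add: in_corner_def)
  with z show False by simp
qed

text \<open>Induction on dim V, measured by traces because the ring never changes. An injective C
  leads to dim W, which is smaller since U is non-zero.\<close>

theorem weight_data_exists:
  fixes P :: "'n::finite sqmat"
  assumes "principal_blocks P Q A C D X Y N" "P + Q \<noteq> 0"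
  shows "\<exists>u w. weight_pair u w \<and> weight_data sq_trace P Q X Y N u w"
proof -
  have "\<exists>u w. weight_pair u w \<and> weight_data sq_trace P Q X Y N u w"
    if "principal_blocks P Q A C D X Y N" "P + Q \<noteq> 0" "sq_trace P + sq_trace Q = of_nat n"
    for n and P Q A C D X Y N :: "'n sqmat"
    using that
  proof (induction n arbitrary: P Q A C D X Y N rule: less_induct)
    case (less n)
    \<comment> \<open>Stated for arbitrary blocks of the same total rank, so that it also applies to
      the transposed data when C is surjective.\<close>
    have injective: "\<exists>u w. weight_pair u w \<and> weight_data sq_trace P Q X Y N u w"
      if pb: "principal_blocks P Q A C D X Y N" and n: "sq_trace P + sq_trace Q = of_nat n"
        and nz: "P \<noteq> 0" "Q \<noteq> 0" and G: "in_corner P Q G" "G * C = P"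
      for P Q A C D X Y N G :: "'n sqmat"
    proof -
      interpret principal_blocks P Q A C D X Y N by fact
      obtain m1 where m1: "sq_trace P = of_nat m1" "m1 \<noteq> 0"
        using sq_trace_idempotent[OF PP] nz by metis
      obtain m2 where m2: "sq_trace Q = of_nat m2"
        using sq_trace_idempotent[OF QQ] by metis
      have "of_nat (m1 + m2) = (of_nat n :: complex)" using n m1 m2 by simp
      then have "m2 < n" using m1 by (metis add.commute less_add_same_cancel1 neq0_conv of_nat_eq_iff)
      moreover have "sq_trace (C * G) + sq_trace (Q - C * G) = of_nat m2"
        using m2 by (simp flip: sq_trace_add)
      ultimately obtain u w where "weight_pair u w" "weight_data sq_trace (C * G) (Q - C * G)
          (C * G * Y * (C * G)) ((Q - C * G) * Y * (Q - C * G)) (C * G * Y * (Q - C * G)) u w"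
        using less.IH[OF _ reduced_principal[OF G]] nz by auto
      then show ?thesis
        using weight_data_lift[OF pb G, of sq_trace] weight_pair.inj sq_trace_add sq_trace_commute by blast
    qed
    interpret principal_blocks P Q A C D X Y N by (rule less.prems)
    note dual = principal_blocks_transpose[OF less.prems(1)]
    consider "Q = 0" | "P = 0" | "P \<noteq> 0" "Q \<noteq> 0" by blast
    then show ?case
    proof cases
      case 1
      then show ?thesis using weight_data_base[OF less.prems(1)] less.prems(2) weight_pair.left by auto
    next
      case 2
      then have "sq_transpose Q \<noteq> 0" using less.prems(2) by (metis add_0 sq_transpose_simps(5,7))
      then have "weight_data sq_trace P Q X Y N (\<lambda>k. 0) (\<lambda>k. if k = 0 then 1 else 0)"
        using weight_data_transpose[OF weight_data_base[OF dual]] 2 by simp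
      then show ?thesis using weight_pair.right by blast
    next
      case 3
      obtain G0 where G0: "C * G0 * C = C" using sq_regular by blast
      \<comment> \<open>Compression puts an arbitrary generalized inverse of C into the corner
        Hom(W,U) and keeps \<open>C * G * C = C\<close>.\<close>
      define G where "G = P * G0 * Q"
      have G: "in_corner P Q G"
        by (simp add: in_corner_def G_def mult.assoc QQ mult_extend[OF PP])
      have CGC: "C * G * C = C"
        using C G0 unfolding G_def in_corner_def by (metis mult.assoc)
      have "G * C = P \<or> C * G = Q"
        using CGC G by (rule one_sided_inverse) (metis sq_prime)
      then show ?thesis
      proof
        assume "G * C = P"
        then show ?thesis using injective[OF less.prems(1,3) 3 G] by blast
      next
        assume CG: "C * G = Q"
        have "\<exists>u w. weight_pair u w \<and> weight_data sq_trace (sq_transpose Q) (sq_transpose P)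
           (- sq_transpose Y) (- sq_transpose X) (- sq_transpose N) u w"
        proof (rule injective[OF dual])
          show "sq_trace (sq_transpose Q) + sq_trace (sq_transpose P) = of_nat n"
            using less.prems(3) by (simp add: add.commute)
          show "sq_transpose Q \<noteq> 0" "sq_transpose P \<noteq> 0" using 3 by (metis sq_transpose_simps(5,7))+
          show "in_corner (sq_transpose Q) (sq_transpose P) (sq_transpose G)" using G by simp
          show "sq_transpose G * sq_transpose C = sq_transpose Q" using CG by (simp flip: sq_transpose_simps(1))
        qed
        then show ?thesis using weight_data_transpose weight_pair_dual by blast
      qed
    qed
  qed
  moreover obtain n m where "sq_trace P = of_nat n" "sq_trace Q = of_nat m"
    using assms(1) sq_trace_idempotent unfolding principal_blocks_def frobenius_blocks_def parabolic_blocks_def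
    by metis
  ultimately show ?thesis using assms of_nat_add by metis
qed

section \<open>Dimensions of eigenspaces\<close>

definition cmat_unit :: "'m \<times> 'n \<Rightarrow> complex^'n^'m" where
  "cmat_unit p = (\<chi> i j. if i = fst p \<and> j = snd p then 1 else 0)"

lemma cmat_sum_component: "(\<Sum>p\<in>S. (f p :: complex^'n^'m)) $ i $ j = (\<Sum>p\<in>S. f p $ i $ j)"
  by (induction S rule: infinite_finite_induct) simp_all

lemma cmat_expand: "x = (\<Sum>p\<in>UNIV. cmat_scale (x $ fst p $ snd p) (cmat_unit p))"
  for x :: "complex^'n::finite^'m::finite"
proof -
  have "(\<Sum>p\<in>UNIV. cmat_scale (x $ fst p $ snd p) (cmat_unit p)) $ i $ j = x $ i $ j" for i j
  proof -
    have "(\<Sum>p\<in>UNIV. x $ fst p $ snd p * cmat_unit p $ i $ j) = (\<Sum>p\<in>UNIV. if p = (i, j) then x $ i $ j else 0)"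
      by (intro sum.cong) (auto simp: cmat_unit_def)
    then show ?thesis by (simp add: cmat_sum_component)
  qed
  then show ?thesis by (simp add: vec_eq_iff)
qed

lemma cmat_finite_independent:
  fixes B :: "(complex^'n::finite^'m::finite) set"
  assumes "cmat.independent B"
  shows "finite B"
proof -
  have "x \<in> cmat.span (range cmat_unit)" for x :: "complex^'n^'m"
    by (subst cmat_expand) (intro cmat.span_sum cmat.span_scale cmat.span_base, simp)
  then have "B \<subseteq> cmat.span (range cmat_unit)" by blast
  then show ?thesis using cmat.independent_span_bound[OF _ assms, of "range cmat_unit"] by simp
qed

text \<open>The rank of a projection is its trace, computed once with matrix units and once with a
  basis of the image. This turns dimensions of eigenspaces into products of traces.\<close>

lemma cmat_dim_projection:
  fixes \<pi> :: "complex^'n::finite^'m::finite \<Rightarrow> complex^'n^'m"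
  assumes add: "\<And>x y. \<pi> (x + y) = \<pi> x + \<pi> y"
    and scale: "\<And>c x. \<pi> (cmat_scale c x) = cmat_scale c (\<pi> x)"
    and idem: "\<And>x. \<pi> (\<pi> x) = \<pi> x"
  shows "of_nat (cmat.dim (range \<pi>)) = (\<Sum>p\<in>UNIV. \<pi> (cmat_unit p) $ fst p $ snd p)"
proof -
  obtain B where B: "B \<subseteq> range \<pi>" "cmat.independent B" "range \<pi> \<subseteq> cmat.span B" "card B = cmat.dim (range \<pi>)"
    by (rule cmat.basis_exists[of "range \<pi>"])
  have fin: "finite B" by (rule cmat_finite_independent[OF B(2)])
  have zero: "\<pi> 0 = 0" using add[of 0 0] by simp
  have \<pi>_sum: "\<pi> (sum f S) = (\<Sum>p\<in>S. \<pi> (f p))" for f and S :: "('m \<times> 'n) set"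
    by (induction S rule: infinite_finite_induct) (simp_all add: add zero)
  have span: "\<pi> x \<in> cmat.span B" for x using B by blast
  let ?r = "cmat.representation B"
  have "\<pi> (cmat_unit p) $ i $ j = (\<Sum>b\<in>B. ?r (\<pi> (cmat_unit p)) b * b $ i $ j)" for p i j
  proof -
    have "(\<Sum>b\<in>B. cmat_scale (?r (\<pi> (cmat_unit p)) b) b) = \<pi> (cmat_unit p)"
      by (rule cmat.sum_representation_eq) (use B fin span in auto)
    then show ?thesis by (metis (no_types, lifting) cmat_sum_component cmat_scale_component sum.cong)
  qed
  then have "(\<Sum>p\<in>UNIV. \<pi> (cmat_unit p) $ fst p $ snd p) =
      (\<Sum>b\<in>B. \<Sum>p\<in>UNIV. b $ fst p $ snd p * ?r (\<pi> (cmat_unit p)) b)"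
    by (simp add: mult.commute) (rule sum.swap)
  also have "\<dots> = (\<Sum>b\<in>B. ?r b b)"
  proof (intro sum.cong refl)
    fix b assume "b \<in> B"
    then have "\<pi> b = b" using B idem by auto
    then have "b = \<pi> (\<Sum>p\<in>UNIV. cmat_scale (b $ fst p $ snd p) (cmat_unit p))"
      using cmat_expand[of b] by simp
    then have b: "b = (\<Sum>p\<in>UNIV. cmat_scale (b $ fst p $ snd p) (\<pi> (cmat_unit p)))"
      by (simp add: \<pi>_sum scale)
    have "?r (\<Sum>p\<in>UNIV. cmat_scale (b $ fst p $ snd p) (\<pi> (cmat_unit p))) b =
        (\<Sum>p\<in>UNIV. b $ fst p $ snd p * ?r (\<pi> (cmat_unit p)) b)"
      using B(2) span by (simp add: cmat.representation_sum cmat.representation_scale cmat.span_scale)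
    then show "(\<Sum>p\<in>UNIV. b $ fst p $ snd p * ?r (\<pi> (cmat_unit p)) b) = ?r b b"
      using b by simp
  qed
  also have "\<dots> = (\<Sum>b\<in>B. 1)"
    by (intro sum.cong) (simp_all add: cmat.representation_basis[OF B(2)])
  finally show ?thesis using B(4) by simp
qed

lift_definition sq_scalar :: "complex \<Rightarrow> 'n::finite sqmat" is mat .

lemma sq_scalar_add: "sq_scalar (c + d) = sq_scalar c + sq_scalar d"
  by transfer (simp add: mat_def vec_eq_iff)

lemma sq_scalar_0 [simp]: "sq_scalar 0 = 0" by transfer (simp add: mat_def vec_eq_iff)

lemma sq_scalar_1 [simp]: "sq_scalar 1 = 1" by transfer simp

lemma sq_scalar_of_int [simp]: "sq_scalar (of_int k) = of_int k"
proof -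
  have minus: "sq_scalar (- c) = - sq_scalar c" for c
    by transfer (simp add: mat_def vec_eq_iff)
  have "sq_scalar (of_nat n) = of_nat n" for n
    by (induction n) (simp_all add: sq_scalar_add)
  then show ?thesis by (cases k rule: int_cases2) (simp_all add: minus)
qed

lemma to_matrix_scalar_mult: "to_matrix (sq_scalar c * x) = cmat_scale c (to_matrix x)"
  by transfer (simp add: matrix_matrix_mult_def mat_def vec_eq_iff if_distrib if_distribR cong: if_cong)

lemma sq_scalar_commute: "x * sq_scalar c = sq_scalar c * x"
  by transfer (simp add: matrix_matrix_mult_def mat_def vec_eq_iff if_distrib if_distribR mult.commute cong: if_cong)

lemma sq_scalar_commute_left: "x * (sq_scalar c * y) = sq_scalar c * (x * y)"
  by (metis mult.assoc sq_scalar_commute)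

lemma central_scalar: "central (sq_scalar c)"
  by (simp add: central_def sq_scalar_commute)

lemma sq_trace_scalar_mult: "sq_trace (sq_scalar c * x) = c * sq_trace x"
  using to_matrix_scalar_mult[of c x] by (simp add: sq_trace.rep_eq trace_def sum_distrib_left)

lemma sq_trace_0 [simp]: "sq_trace 0 = 0"
  using sq_trace_scalar_mult[of 0 0] by simp

lemma sq_trace_minus: "sq_trace (x - y) = sq_trace x - sq_trace y"
  using sq_trace_add[of "x - y" y] by simp

lemma sq_trace_nondegenerate:
  assumes "\<And>y. sq_trace (R * y) = 0"
  shows "R = 0"
proof -
  have "trace (to_matrix R ** y) = 0" for y
    using assms[of "of_matrix y"] by (simp add: sq_trace.rep_eq times_sqmat.rep_eq of_matrix_inverse)
  moreover have "trace (to_matrix R ** cmat_unit (j, i)) = to_matrix R $ i $ j" for i j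
  proof -
    have "(to_matrix R ** cmat_unit (j, i)) $ k $ k = (if k = i then to_matrix R $ i $ j else 0)" for k
      by (cases "k = i") (simp_all add: matrix_matrix_mult_def cmat_unit_def if_distrib cong: if_cong)
    then show ?thesis by (simp add: trace_def)
  qed
  ultimately have "to_matrix R = 0" by (simp add: vec_eq_iff)
  then show ?thesis by (metis to_matrix_inject zero_sqmat.rep_eq)
qed

lemma sq_trace_representation:
  fixes F :: "complex^'n::finite^'n \<Rightarrow> complex"
  assumes add: "\<And>x y. F (x + y) = F x + F y" and scale: "\<And>c x. F (cmat_scale c x) = c * F x"
  obtains M where "\<And>x. F (to_matrix x) = sq_trace (M * x)"
proof -
  \<comment> \<open>The indices are swapped because the trace of M times the matrix unit at (j, i)
    is the entry of M at (i, j).\<close>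
  define M where "M = (\<chi> i j. F (cmat_unit (j, i)))"
  have zero: "F 0 = 0" using add[of 0 0] by simp
  have F_sum: "F (sum f S) = (\<Sum>p\<in>S. F (f p))" for f and S :: "('n \<times> 'n) set"
    by (induction S rule: infinite_finite_induct) (simp_all add: add zero)
  have "F x = trace (M ** x)" for x
  proof -
    have "F x = (\<Sum>p\<in>UNIV. x $ fst p $ snd p * F (cmat_unit p))"
      by (subst cmat_expand) (simp add: F_sum scale)
    also have "\<dots> = (\<Sum>i\<in>UNIV. \<Sum>j\<in>UNIV. x $ i $ j * F (cmat_unit (i, j)))"
      by (simp add: sum.cartesian_product split_def)
    also have "\<dots> = trace (M ** x)"
      unfolding trace_def matrix_matrix_mult_def M_def by (simp add: mult.commute) (rule sum.swap)
    finally show ?thesis .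
  qed
  then have "F (to_matrix x) = sq_trace (of_matrix M * x)" for x
    by (simp add: sq_trace.rep_eq times_sqmat.rep_eq of_matrix_inverse)
  with that show ?thesis by blast
qed

section \<open>Peirce blocks and eigenspaces of ad\<close>

lemma sq_dim_pairs:
  fixes \<eta> :: "'i \<Rightarrow> 'n::finite sqmat"
  assumes I: "finite I" and K: "K \<subseteq> I \<times> I"
    and orth: "\<And>i j. i \<in> I \<Longrightarrow> j \<in> I \<Longrightarrow> \<eta> i * \<eta> j = (if i = j then \<eta> i else 0)"
    and total: "sum \<eta> I = 1"
  shows "of_nat (cmat.dim {to_matrix x | x. \<forall>i\<in>I. \<forall>j\<in>I. (i, j) \<notin> K \<longrightarrow> \<eta> i * x * \<eta> j = 0}) =
    (\<Sum>p\<in>K. sq_trace (\<eta> (fst p)) * sq_trace (\<eta> (snd p)))"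
proof -
  have finK: "finite K" using I K finite_subset by blast
  \<comment> \<open>The projection to the Peirce blocks selected by K. Each summand a x b has trace
    tr(a) tr(b) as a linear map in x, which gives the dimension formula.\<close>
  define \<rho> where "\<rho> x = (\<Sum>p\<in>K. \<eta> (fst p) * x * \<eta> (snd p))" for x
  define \<pi> where "\<pi> X = to_matrix (\<rho> (of_matrix X))" for X
  have \<rho>_pair: "\<eta> i * \<rho> x * \<eta> j = (if (i, j) \<in> K then \<eta> i * x * \<eta> j else 0)" if ij: "i \<in> I" "j \<in> I" for i j x
  proof -
    have "\<eta> i * \<rho> x * \<eta> j = (\<Sum>p\<in>K. \<eta> i * \<eta> (fst p) * x * (\<eta> (snd p) * \<eta> j))"
      by (simp add: \<rho>_def sum_distrib_left sum_distrib_right mult.assoc)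
    also have "\<dots> = (\<Sum>p\<in>K. if p = (i, j) then \<eta> i * x * \<eta> j else 0)"
    proof (intro sum.cong refl)
      fix p assume "p \<in> K"
      then have "fst p \<in> I" "snd p \<in> I" using K by auto
      then show "\<eta> i * \<eta> (fst p) * x * (\<eta> (snd p) * \<eta> j) = (if p = (i, j) then \<eta> i * x * \<eta> j else 0)"
        using ij by (cases p) (auto simp: orth)
    qed
    finally show ?thesis using finK by simp
  qed
  have \<rho>_fix: "\<rho> x = x" if x: "\<forall>i\<in>I. \<forall>j\<in>I. (i, j) \<notin> K \<longrightarrow> \<eta> i * x * \<eta> j = 0" for x
  proof -
    have "x = sum \<eta> I * x * sum \<eta> I" by (simp add: total)
    also have "\<dots> = (\<Sum>p\<in>I \<times> I. \<eta> (fst p) * x * \<eta> (snd p))"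
      unfolding sum_distrib_left sum_distrib_right
      by (subst sum.swap) (simp add: sum.cartesian_product split_def)
    also have "\<dots> = \<rho> x"
      unfolding \<rho>_def by (rule sum.mono_neutral_right) (use I K x in auto)
    finally show ?thesis by simp
  qed
  have of_to: "of_matrix (to_matrix x) = x" "to_matrix (of_matrix X) = X" for x :: "'n sqmat" and X
    by (simp_all add: to_matrix_inverse of_matrix_inverse)
  have range: "range \<pi> = {to_matrix x | x. \<forall>i\<in>I. \<forall>j\<in>I. (i, j) \<notin> K \<longrightarrow> \<eta> i * x * \<eta> j = 0}" (is "_ = ?R")
  proof
    show "range \<pi> \<subseteq> ?R" using \<rho>_pair by (auto simp: \<pi>_def)
    show "?R \<subseteq> range \<pi>"
    proof
      fix X assume "X \<in> ?R"
      then obtain x where "X = to_matrix x" "\<rho> x = x" using \<rho>_fix by blast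
      then have "\<pi> X = X" by (simp add: \<pi>_def of_to)
      then show "X \<in> range \<pi>" by (metis rangeI)
    qed
  qed
  have "of_nat (cmat.dim (range \<pi>)) = (\<Sum>p\<in>UNIV. \<pi> (cmat_unit p) $ fst p $ snd p)"
  proof (rule cmat_dim_projection)
    show "\<pi> (X + Y) = \<pi> X + \<pi> Y" for X Y
      by (simp add: \<pi>_def \<rho>_def distrib_left distrib_right sum.distrib flip: plus_sqmat.abs_eq plus_sqmat.rep_eq)
    show "\<pi> (cmat_scale c X) = cmat_scale c (\<pi> X)" for c X
    proof -
      have "of_matrix (cmat_scale c X) = sq_scalar c * of_matrix X"
        by (metis of_to to_matrix_scalar_mult)
      then show ?thesis
        by (simp add: \<pi>_def \<rho>_def mult.assoc sq_scalar_commute_left sum_distrib_left flip: to_matrix_scalar_mult)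
    qed
    have "\<rho> (\<rho> x) = \<rho> x" for x by (rule \<rho>_fix) (simp add: \<rho>_pair)
    then show "\<pi> (\<pi> X) = \<pi> X" for X by (simp add: \<pi>_def of_to)
  qed
  also have "\<dots> = (\<Sum>p\<in>UNIV. \<Sum>q\<in>K. to_matrix (\<eta> (fst q)) $ fst p $ fst p * to_matrix (\<eta> (snd q)) $ snd p $ snd p)"
  proof (intro sum.cong refl)
    fix p :: "'n \<times> 'n"
    have "(a ** cmat_unit p ** b) $ fst p $ snd p = a $ fst p $ fst p * b $ snd p $ snd p" for a b :: "complex^'n^'n"
    proof -
      have "(a ** cmat_unit p) $ fst p $ m = (if m = snd p then a $ fst p $ fst p else 0)" for m
        by (cases "m = snd p") (simp_all add: matrix_matrix_mult_def cmat_unit_def if_distrib cong: if_cong)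
      then show ?thesis
        by (subst matrix_matrix_mult_def) (simp add: if_distrib[of "\<lambda>x. x * _"] cong: if_cong)
    qed
    moreover have "to_matrix (sum f K) = (\<Sum>q\<in>K. to_matrix (f q))" for f :: "'i \<times> 'i \<Rightarrow> 'n sqmat"
      by (induction K rule: infinite_finite_induct) (simp_all add: zero_sqmat.rep_eq plus_sqmat.rep_eq)
    ultimately show "\<pi> (cmat_unit p) $ fst p $ snd p =
      (\<Sum>q\<in>K. to_matrix (\<eta> (fst q)) $ fst p $ fst p * to_matrix (\<eta> (snd q)) $ snd p $ snd p)"
      by (simp add: \<pi>_def \<rho>_def times_sqmat.rep_eq of_to cmat_sum_component)
  qed
  also have "\<dots> = (\<Sum>q\<in>K. \<Sum>p\<in>UNIV. to_matrix (\<eta> (fst q)) $ fst p $ fst p * to_matrix (\<eta> (snd q)) $ snd p $ snd p)"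
    by (rule sum.swap)
  also have "\<dots> = (\<Sum>q\<in>K. sq_trace (\<eta> (fst q)) * sq_trace (\<eta> (snd q)))"
    by (simp add: sq_trace.rep_eq trace_def sum_product sum.cartesian_product split_def)
  finally show ?thesis by (simp only: range)
qed

lemma corr_double_sum:
  assumes S: "finite S" "{k. f k \<noteq> 0} \<subseteq> S" "{k. g k \<noteq> 0} \<subseteq> S"
  shows "corr f g l = (\<Sum>i\<in>S. \<Sum>j\<in>S. if i - j = l then f i * g j else 0)"
proof -
  have "(\<Sum>i\<in>S. \<Sum>j\<in>S. if i - j = l then f i * g j else 0) =
      (\<Sum>j\<in>S. \<Sum>i\<in>S. if i - j = l then f i * g j else 0)"
    by (rule sum.swap)
  also have "\<dots> = (\<Sum>j\<in>S. f (j + l) * g j)"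
  proof (intro sum.cong refl)
    fix j
    have "(\<Sum>i\<in>S. if i - j = l then f i * g j else 0) = (\<Sum>i\<in>S. if i = j + l then f (j + l) * g j else 0)"
      by (intro sum.cong) auto
    also have "\<dots> = f (j + l) * g j" using S by auto
    finally show "(\<Sum>i\<in>S. if i - j = l then f i * g j else 0) = f (j + l) * g j" .
  qed
  finally show ?thesis using corr_superset[OF S(1,3)] by simp
qed

text \<open>Conjugating the projections of X + Y by \<open>1 - T\<close> yields those of h. Under ad
  h the block of x between two of them is multiplied by the difference of their weights, so the
  eigenspace is the sum of the blocks with difference l; invariance of U deletes the blocks from U
  to W.\<close>

lemma eigenspace_dims:
  fixes P :: "'n::finite sqmat"
  assumes PP: "P * P = P" and QQ: "Q * Q = Q" and PQ: "P * Q = 0" and QP: "Q * P = 0" and PQ1: "P + Q = 1"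
    and X: "in_corner P P X" and Y: "in_corner Q Q Y"
    and wd: "weight_data sq_trace P Q X Y N u w"
  defines "h \<equiv> X + Y + N"
  shows "cmat.dim {to_matrix x | x. h * x - x * h = of_int l * x} =
      corr u u l + corr w w l + corr u w l + corr w u l" (is ?gl)
    and "cmat.dim {to_matrix x | x. Q * x * P = 0 \<and> h * x - x * h = of_int l * x} =
      corr u u l + corr w w l + corr u w l" (is ?par)
proof -
  obtain z e f T where z: "central z" and e: "weights z P X e" and f: "weights z Q Y f"
    and T: "in_corner P Q T" and N: "N = X * T - T * Y"
    and tr_e: "\<And>k. sq_trace (e k) = of_nat (u k)" and tr_f: "\<And>k. sq_trace (f k) = of_nat (w k)"
    using wd unfolding weight_data_def by blast
  define L where "L = 1 - T"
  define R where "R = 1 + T"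
  have corner: "P * e k = e k" "e k * P = e k" "Q * f k = f k" "f k * Q = f k" for k
    using weights_corner[OF e] weights_corner[OF f] by (auto simp: in_corner_def)
  have ortho: "x * P = x \<Longrightarrow> Q * y = y \<Longrightarrow> x * y = 0" "x * Q = x \<Longrightarrow> P * y = y \<Longrightarrow> x * y = 0" for x y
    using PQ QP by (metis mult.assoc mult_zero_left mult_zero_right)+
  have XYT: "X * P = X" "P * X = X" "Q * Y = Y" "Y * Q = Y" "P * T = T" "T * Q = T"
    using X Y T by (auto simp: in_corner_def)
  have zero: "T * T = 0" "Y * T = 0" "T * X = 0" "T * P = 0" "Q * T = 0"
      "e i * f j = 0" "f j * e i = 0" "Y * e i = 0" "e i * Y = 0" "X * f i = 0" "f i * X = 0" for i j
    by (rule ortho(1) ortho(2); rule XYT corner PP QQ)+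
  have Xe: "X * e k = (z + of_int k) * e k" "e k * X = (z + of_int k) * e k"
    and Yf: "Y * f k = (z + of_int k) * f k" "f k * Y = (z + of_int k) * f k" for k
    using e f unfolding weights_def by blast+
  have ee: "e i * e j = (if i = j then e i else 0)" and ff: "f i * f j = (if i = j then f i else 0)" for i j
    using e f unfolding weights_def by blast+
  have LR: "L * R = 1" "R * L = 1" by (simp_all add: L_def R_def algebra_simps zero)
  have hL: "h * L = L * (X + Y)" and Rh: "R * h = (X + Y) * R"
    by (simp_all add: L_def R_def h_def N algebra_simps zero mult_extend[OF zero(1)] mult_extend[OF zero(2)]
      mult_extend[OF zero(3)])
  \<comment> \<open>The Boolean tag keeps equal weights on U (\<open>True\<close>) and on W
    (\<open>False\<close>) apart, as the flag condition distinguishes them.\<close>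
  define \<eta> where "\<eta> i = L * (if fst i then e (snd i) else f (snd i)) * R" for i :: "bool \<times> int"
  define t where "t i = (if fst i then u (snd i) else w (snd i))" for i :: "bool \<times> int"
  have tr_\<eta>: "sq_trace (\<eta> i) = of_nat (t i)" for i
  proof -
    have "sq_trace (L * x * R) = sq_trace x" for x
      using sq_trace_commute[of "L * x" R] by (simp add: LR flip: mult.assoc)
    then show ?thesis by (simp add: \<eta>_def t_def tr_e tr_f)
  qed
  have eigen_left: "h * \<eta> i = (z + of_int (snd i)) * \<eta> i" for i
  proof -
    have "h * \<eta> i = L * ((X + Y) * (if fst i then e (snd i) else f (snd i))) * R"
      by (simp add: \<eta>_def mult.assoc mult_extend[OF hL])
    also have "(X + Y) * (if fst i then e (snd i) else f (snd i)) =
        (z + of_int (snd i)) * (if fst i then e (snd i) else f (snd i))"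
      by (simp add: distrib_right[of X] zero Xe Yf)
    finally show ?thesis by (simp only: \<eta>_def mult.assoc central_commute[OF z])
  qed
  have eigen_right: "\<eta> i * h = (z + of_int (snd i)) * \<eta> i" for i
  proof -
    have "\<eta> i * h = L * ((if fst i then e (snd i) else f (snd i)) * (X + Y)) * R"
      by (simp add: \<eta>_def mult.assoc Rh)
    also have "(if fst i then e (snd i) else f (snd i)) * (X + Y) =
        (z + of_int (snd i)) * (if fst i then e (snd i) else f (snd i))"
      by (simp add: distrib_left[of _ X] zero Xe Yf)
    finally show ?thesis by (simp only: \<eta>_def mult.assoc central_commute[OF z])
  qed
  define S where "S = {k. e k \<noteq> 0} \<union> {k. f k \<noteq> 0}"
  have S: "finite S" "sum e S = P" "sum f S = Q"
    using e f weights_sum[OF e, of S] weights_sum[OF f, of S] by (auto simp only: S_def weights_def)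
  have supp: "{k. u k \<noteq> 0} \<subseteq> S" "{k. w k \<noteq> 0} \<subseteq> S"
  proof -
    have "e k = 0 \<Longrightarrow> u k = 0" "f k = 0 \<Longrightarrow> w k = 0" for k
      using tr_e[of k] tr_f[of k] by auto
    then show "{k. u k \<noteq> 0} \<subseteq> S" "{k. w k \<noteq> 0} \<subseteq> S" by (auto simp: S_def)
  qed
  define I where "I = (UNIV :: bool set) \<times> S"
  have sum_I: "sum g I = (\<Sum>k\<in>S. g (True, k)) + (\<Sum>k\<in>S. g (False, k))" for g :: "bool \<times> int \<Rightarrow> 'c::comm_monoid_add"
  proof -
    have "sum g I = (\<Sum>b\<in>UNIV. \<Sum>k\<in>S. g (b, k))"
      unfolding I_def by (simp add: sum.cartesian_product split_def)
    then show ?thesis by (simp add: UNIV_bool add.commute)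
  qed
  have finI: "finite I" using S by (simp add: I_def)
  have total: "sum \<eta> I = 1"
  proof -
    have "sum \<eta> I = L * (sum e S + sum f S) * R"
      by (simp add: sum_I \<eta>_def distrib_left distrib_right sum_distrib_left sum_distrib_right)
    then show ?thesis by (simp add: S PQ1 LR)
  qed
  have orth: "\<eta> i * \<eta> j = (if i = j then \<eta> i else 0)" for i j
  proof -
    have "\<eta> i * \<eta> j = L * ((if fst i then e (snd i) else f (snd i)) * (if fst j then e (snd j) else f (snd j))) * R"
      by (simp add: \<eta>_def mult.assoc mult_extend[OF LR(2)])
    then show ?thesis by (auto simp: \<eta>_def zero ee ff prod_eq_iff)
  qed
  have full: "x = 0 \<longleftrightarrow> (\<forall>i\<in>I. \<forall>j\<in>I. \<eta> i * x * \<eta> j = 0)" for x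
  proof
    assume "\<forall>i\<in>I. \<forall>j\<in>I. \<eta> i * x * \<eta> j = 0"
    then have "(\<Sum>i\<in>I. \<Sum>j\<in>I. \<eta> i * x * \<eta> j) = 0" by simp
    moreover have "(\<Sum>i\<in>I. \<Sum>j\<in>I. \<eta> i * x * \<eta> j) = sum \<eta> I * x * sum \<eta> I"
      by (simp add: sum_distrib_left sum_distrib_right) (rule sum.swap)
    ultimately show "x = 0" by (simp add: total)
  qed simp
  have eigen: "h * x - x * h = of_int l * x \<longleftrightarrow>
      (\<forall>i\<in>I. \<forall>j\<in>I. snd i - snd j \<noteq> l \<longrightarrow> \<eta> i * x * \<eta> j = 0)" for x
  proof -
    have "\<eta> i * (h * x - x * h - of_int l * x) * \<eta> j = of_int (snd i - snd j - l) * (\<eta> i * x * \<eta> j)" for i j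
    proof -
      have "\<eta> i * (h * x - x * h - of_int l * x) * \<eta> j =
          (\<eta> i * h) * (x * \<eta> j) - \<eta> i * x * (h * \<eta> j) - \<eta> i * (of_int l * (x * \<eta> j))"
        by (simp only: mult.assoc right_diff_distrib left_diff_distrib)
      also have "\<dots> = (z + of_int (snd i)) * (\<eta> i * x * \<eta> j) - (z + of_int (snd j)) * (\<eta> i * x * \<eta> j)
           - of_int l * (\<eta> i * x * \<eta> j)"
        \<comment> \<open>The instance with central element 0 moves the plain integer l past
          \<open>\<eta> i\<close>.\<close>
        using central_commute[of 0 "\<eta> i" l "x * \<eta> j"] 
        by (simp only: eigen_left eigen_right mult.assoc central_commute[OF z]) (simp add: central_def)
      finally show ?thesis by (simp add: algebra_simps)
    qed
    then have "h * x - x * h - of_int l * x = 0 \<longleftrightarrow>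
        (\<forall>i\<in>I. \<forall>j\<in>I. of_int (snd i - snd j - l) * (\<eta> i * x * \<eta> j) = 0)"
      by (subst full) (simp only:)
    moreover have "of_int k * y = 0 \<longleftrightarrow> k = 0 \<or> y = 0" for k and y :: "'n sqmat"
      by (metis mult_zero_left of_int_0 of_int_eq_0_iff of_real_of_int_eq scaleR_conv_of_real scaleR_eq_0_iff)
    ultimately have "h * x - x * h - of_int l * x = 0 \<longleftrightarrow>
        (\<forall>i\<in>I. \<forall>j\<in>I. snd i - snd j - l = 0 \<or> \<eta> i * x * \<eta> j = 0)"
      by (simp only:)
    then show ?thesis by auto
  qed
  have flag: "Q * x * P = 0 \<longleftrightarrow> (\<forall>i\<in>I. \<forall>j\<in>I. \<not> fst i \<and> fst j \<longrightarrow> \<eta> i * x * \<eta> j = 0)" for x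
  proof
    \<comment> \<open>\<open>1 + T\<close> and \<open>1 - T\<close> preserve U and induce the
      identity on U and on V/U, so the conjugated idempotents detect the same maps from U to W as P
      and Q do.\<close>
    have QR: "Q * R = Q" and LP: "L * P = P" by (simp_all add: R_def L_def algebra_simps zero)
    assume *: "Q * x * P = 0"
    have "\<eta> (False, k) * x * \<eta> (True, m) = 0" for k m
    proof -
      have "\<eta> (False, k) * x * \<eta> (True, m) = L * (f k * Q) * R * x * L * (P * e m) * R"
        by (simp only: corner) (simp add: \<eta>_def mult.assoc)
      also have "\<dots> = L * f k * (Q * x * P) * e m * R"
        by (simp only: mult.assoc mult_extend[OF QR] mult_extend[OF LP])
      finally show ?thesis by (simp add: *)
    qed
    then show "\<forall>i\<in>I. \<forall>j\<in>I. \<not> fst i \<and> fst j \<longrightarrow> \<eta> i * x * \<eta> j = 0" by (auto simp: I_def)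
  next
    assume *: "\<forall>i\<in>I. \<forall>j\<in>I. \<not> fst i \<and> fst j \<longrightarrow> \<eta> i * x * \<eta> j = 0"
    have "L * Q * R * x * (L * P * R) = (\<Sum>k\<in>S. \<Sum>m\<in>S. \<eta> (False, k) * x * \<eta> (True, m))"
      unfolding S(2,3)[symmetric] by (simp add: \<eta>_def sum_distrib_left sum_distrib_right) (rule sum.swap)
    also have "\<dots> = 0"
      by (intro sum.neutral ballI) (use * in \<open>simp add: I_def\<close>, blast)
    finally have "Q * (L * Q * R * x * (L * P * R)) * P = 0" by simp
    moreover have "Q * (L * (Q * (R * y))) = Q * y" "L * (P * (R * P)) = P" for y
      by (simp_all add: R_def L_def algebra_simps zero QQ PP mult_extend[OF zero(5)] mult_extend[OF QQ])
    ultimately show "Q * x * P = 0" by (simp add: mult.assoc)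
  qed
  have dim_K: "cmat.dim {to_matrix x | x. \<forall>i\<in>I. \<forall>j\<in>I. \<not> \<phi> i j \<longrightarrow> \<eta> i * x * \<eta> j = 0} =
      (\<Sum>i\<in>I. \<Sum>j\<in>I. if \<phi> i j then t i * t j else 0)" for \<phi>
  proof -
    let ?K = "{p \<in> I \<times> I. \<phi> (fst p) (snd p)}"
    have "{to_matrix x | x. \<forall>i\<in>I. \<forall>j\<in>I. \<not> \<phi> i j \<longrightarrow> \<eta> i * x * \<eta> j = 0} =
        {to_matrix x | x. \<forall>i\<in>I. \<forall>j\<in>I. (i, j) \<notin> ?K \<longrightarrow> \<eta> i * x * \<eta> j = 0}"
      by auto
    moreover have "of_nat (cmat.dim {to_matrix x | x. \<forall>i\<in>I. \<forall>j\<in>I. (i, j) \<notin> ?K \<longrightarrow> \<eta> i * x * \<eta> j = 0}) =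
        (of_nat (\<Sum>p\<in>?K. t (fst p) * t (snd p)) :: complex)"
      by (subst sq_dim_pairs[OF finI _ orth total]) (auto simp: tr_\<eta>)
    moreover have "(\<Sum>p\<in>?K. t (fst p) * t (snd p)) = (\<Sum>i\<in>I. \<Sum>j\<in>I. if \<phi> i j then t i * t j else 0)"
      using finI by (subst sum.inter_filter) (simp_all add: sum.cartesian_product split_def)
    ultimately show ?thesis by (metis (no_types, lifting) of_nat_eq_iff)
  qed
  note corrs = corr_double_sum[OF S(1) supp(1) supp(1)] corr_double_sum[OF S(1) supp(2) supp(2)]
    corr_double_sum[OF S(1) supp(1) supp(2)] corr_double_sum[OF S(1) supp(2) supp(1)]
  show ?gl
    unfolding eigen dim_K sum_I t_def fst_conv snd_conv if_True if_False corrs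
    by (simp add: sum.distrib)
  have "{to_matrix x | x. Q * x * P = 0 \<and> h * x - x * h = of_int l * x} =
    {to_matrix x | x. \<forall>i\<in>I. \<forall>j\<in>I. \<not> (snd i - snd j = l \<and> (fst i \<or> \<not> fst j)) \<longrightarrow> \<eta> i * x * \<eta> j = 0}"
    unfolding eigen flag by blast
  then have "cmat.dim {to_matrix x | x. Q * x * P = 0 \<and> h * x - x * h = of_int l * x} =
      (\<Sum>i\<in>I. \<Sum>j\<in>I. if snd i - snd j = l \<and> (fst i \<or> \<not> fst j) then t i * t j else 0)"
    by (simp only: dim_K)
  then show ?par
    unfolding sum_I t_def fst_conv snd_conv if_True if_False corrs
    by (simp add: sum.distrib)
qed

section \<open>Frobenius functionals on the parabolic subalgebra\<close>

lift_definition sq_projection :: "'n set \<Rightarrow> 'n::finite sqmat" is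
  "\<lambda>S. \<chi> i j. if i = j \<and> i \<in> S then 1 else 0" .

lemma to_matrix_projections:
  "to_matrix (sq_projection S * x * sq_projection T) $ i $ j = (if i \<in> S \<and> j \<in> T then to_matrix x $ i $ j else 0)"
proof transfer
  fix S T :: "'a set" and x :: "complex^'a^'a" and i j
  let ?D = "\<lambda>S. (\<chi> i j. if i = j \<and> i \<in> S then 1 else 0) :: complex^'a^'a"
  have "(?D S ** x) $ i $ k = (if i \<in> S then x $ i $ k else 0)" for k
    by (cases "i \<in> S") (simp_all add: matrix_matrix_mult_def if_distribR if_distrib[of "\<lambda>y. y * _"] cong: if_cong)
  moreover have "(y ** ?D T) $ i $ j = (if j \<in> T then y $ i $ j else 0)" for y
    by (cases "j \<in> T") (auto simp: matrix_matrix_mult_def intro!: sum.neutral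
      sum.remove[of UNIV j, THEN trans])
  ultimately show "(?D S ** x ** ?D T) $ i $ j = (if i \<in> S \<and> j \<in> T then x $ i $ j else 0)" by simp
qed

lemma sq_projection_simps:
  "sq_projection S * sq_projection T = sq_projection (S \<inter> T)"
  "S \<inter> T = {} \<Longrightarrow> sq_projection S + sq_projection T = sq_projection (S \<union> T)"
  "sq_projection {} = 0" "sq_projection UNIV = 1"
proof -
  show "sq_projection S * sq_projection T = sq_projection (S \<inter> T)"
  proof -
    have "to_matrix (sq_projection S * 1 * sq_projection T) $ i $ j = to_matrix (sq_projection (S \<inter> T)) $ i $ j" for i j
      unfolding to_matrix_projections by (auto simp: sq_projection.rep_eq one_sqmat.rep_eq mat_def)
    then show ?thesis by (simp add: vec_eq_iff flip: to_matrix_inject)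
  qed
qed (transfer, auto simp: vec_eq_iff mat_def)+

lemma to_matrix_lie: "lie (to_matrix x) (to_matrix y) = to_matrix (x * y - y * x)"
  by (simp add: lie_def times_sqmat.rep_eq minus_sqmat.rep_eq)

text \<open>The parabolic subalgebra in terms of idempotents. The trace condition is separate from
  the invariance of U because the block equations live in gl.\<close>

locale graded_frobenius =
  fixes P Q :: "'n::finite sqmat" and F :: "complex^'n^'n \<Rightarrow> complex" and L :: "(complex^'n^'n) set"
  assumes PP: "P * P = P" and QQ: "Q * Q = Q" and PQ: "P * Q = 0" and QP: "Q * P = 0" and one: "P + Q = 1"
    and L: "\<And>x. to_matrix x \<in> L \<longleftrightarrow> sq_trace x = 0 \<and> Q * x * P = 0"
    and F: "frobenius_functional L F"
begin

lemma trace_1_nonzero: "sq_trace (1 :: 'n sqmat) \<noteq> 0"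
  by (simp add: sq_trace.rep_eq one_sqmat.rep_eq trace_I)

lemma F_add: "to_matrix x \<in> L \<Longrightarrow> to_matrix y \<in> L \<Longrightarrow> F (to_matrix (x + y)) = F (to_matrix x) + F (to_matrix y)"
  and F_scale: "to_matrix x \<in> L \<Longrightarrow> F (to_matrix (sq_scalar c * x)) = c * F (to_matrix x)"
  using F by (simp_all add: frobenius_functional_def functional_on_def plus_sqmat.rep_eq to_matrix_scalar_mult)

text \<open>The projection of gl to sl along the scalars. Subtracting a scalar affects neither
  commutators nor the invariance of U.\<close>

definition traceless :: "'n sqmat \<Rightarrow> 'n sqmat" where
  "traceless x = x - sq_scalar (sq_trace x / sq_trace (1 :: 'n sqmat))"

lemma sq_trace_scalar: "sq_trace (sq_scalar c :: 'n sqmat) = c * sq_trace (1 :: 'n sqmat)"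
  using sq_trace_scalar_mult[of c 1] by simp

lemma scalar_flag: "Q * (sq_scalar c * x) * P = sq_scalar c * (Q * x * P)"
  by (simp add: mult.assoc sq_scalar_commute_left)

lemma scalar_flag_0 [simp]: "Q * sq_scalar c * P = 0"
  using scalar_flag[of c 1] by (simp add: QP)

lemma traceless_L: "Q * x * P = 0 \<Longrightarrow> to_matrix (traceless x) \<in> L"
  using trace_1_nonzero
  by (simp add: L traceless_def sq_trace_minus sq_trace_scalar right_diff_distrib left_diff_distrib)

lemma traceless_eq: "sq_trace x = 0 \<Longrightarrow> traceless x = x"
  by (simp add: traceless_def)

lemma commutator_L: "Q * x * P = 0 \<Longrightarrow> Q * y * P = 0 \<Longrightarrow> to_matrix (x * y - y * x) \<in> L"
proof -
  assume xy: "Q * x * P = 0" "Q * y * P = 0"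
  have "Q * (a * b) * P = 0" if "Q * a * P = 0" "Q * b * P = 0" for a b
  proof -
    have "Q * (a * b) * P = Q * a * (P + Q) * b * P" by (simp add: one mult.assoc)
    also have "\<dots> = Q * a * P * b * P + Q * a * (Q * b * P)" by (simp only: distrib_left distrib_right mult.assoc)
    finally show ?thesis using that by simp
  qed
  then show ?thesis
    using xy by (simp add: L sq_trace_minus sq_trace_commute[of x] right_diff_distrib left_diff_distrib)
qed

lemma traceless_add: "traceless (x + y) = traceless x + traceless y"
  by (simp add: traceless_def sq_trace_add add_divide_distrib sq_scalar_add)

lemma traceless_scale: "traceless (sq_scalar c * x) = sq_scalar c * traceless x"
proof -
  have "sq_scalar c * sq_scalar d = (sq_scalar (c * d) :: 'n sqmat)" for d
    by (simp add: vec_eq_iff to_matrix_scalar_mult sq_scalar.rep_eq mat_def flip: to_matrix_inject)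
  then show ?thesis by (simp add: traceless_def sq_trace_scalar_mult right_diff_distrib)
qed

text \<open>F is extended to all matrices by first projecting to L: cut the block from U to W, then
  remove the trace. The extension kills the identity, which makes M traceless.\<close>

lemma representing_matrix:
  obtains M where "\<And>x. to_matrix x \<in> L \<Longrightarrow> F (to_matrix x) = sq_trace (M * x)" "sq_trace M = 0"
proof -
  define p where "p x = traceless (x - Q * x * P)" for x
  have QpP: "Q * (x - Q * x * P) * P = 0" for x
    by (simp add: right_diff_distrib left_diff_distrib mult.assoc PP QQ mult_extend[OF QQ])
  have pL: "to_matrix (p x) \<in> L" for x
    unfolding p_def by (rule traceless_L[OF QpP])
  have p_add: "p (x + y) = p x + p y" for x y
    unfolding p_def traceless_add[symmetric] by (simp add: algebra_simps)
  have p_scale: "p (sq_scalar c * x) = sq_scalar c * p x" for c x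
    unfolding p_def traceless_scale[symmetric] by (simp add: scalar_flag right_diff_distrib)
  define G where "G X = F (to_matrix (p (of_matrix X)))" for X
  have "G (X + Y) = G X + G Y" for X Y
    by (simp add: G_def p_add F_add pL flip: plus_sqmat.abs_eq)
  moreover have "G (cmat_scale c X) = c * G X" for c X
  proof -
    have "of_matrix (cmat_scale c X) = sq_scalar c * of_matrix X"
      by (metis of_matrix_inverse[OF UNIV_I] to_matrix_inverse to_matrix_scalar_mult)
    then show ?thesis by (simp add: G_def p_scale F_scale pL)
  qed
  ultimately obtain M where M: "\<And>x. G (to_matrix x) = sq_trace (M * x)"
    using sq_trace_representation by blast
  have "F (to_matrix x) = sq_trace (M * x)" if "to_matrix x \<in> L" for x
  proof -
    have "p x = x" using that by (simp add: p_def L traceless_eq)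
    then show ?thesis using M[of x] by (simp add: G_def to_matrix_inverse)
  qed
  moreover have "sq_trace M = 0"
  proof -
    have "p 1 = 0" using trace_1_nonzero by (simp add: p_def QP traceless_def)
    moreover have "F (to_matrix (0 :: 'n sqmat)) = 0"
      using F_scale[of 0 0] by (simp add: L)
    ultimately show ?thesis using M[of 1] by (simp add: G_def to_matrix_inverse)
  qed
  ultimately show ?thesis using that by blast
qed

text \<open>Under the trace form, the annihilator of the stabilizer of U is Hom(W,U); this is the
  block of M that F does not see.\<close>

lemma annihilator:
  "(\<forall>y. Q * y * P = 0 \<longrightarrow> sq_trace (R * y) = 0) \<longleftrightarrow> P * R * P = 0 \<and> Q * R * P = 0 \<and> Q * R * Q = 0"
proof
  assume *: "\<forall>y. Q * y * P = 0 \<longrightarrow> sq_trace (R * y) = 0"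
  \<comment> \<open>Under either condition \<open>a * y * b\<close> preserves U for every y, so
    cyclicity of the trace tests \<open>b * R * a\<close> against all matrices.\<close>
  have "b * R * a = 0" if "Q * a = 0 \<or> b * P = 0" for a b
  proof (rule sq_trace_nondegenerate)
    fix y
    have "Q * (a * y * b) * P = 0"
      using that by (metis mult.assoc mult_zero_left mult_zero_right)
    then have "sq_trace (R * (a * y * b)) = 0" using * by blast
    then show "sq_trace (b * R * a * y) = 0"
      using sq_trace_commute[of "R * (a * y)" b] by (simp add: mult.assoc)
  qed
  then show "P * R * P = 0 \<and> Q * R * P = 0 \<and> Q * R * Q = 0"
    using QP by auto
next
  assume *: "P * R * P = 0 \<and> Q * R * P = 0 \<and> Q * R * Q = 0"
  show "\<forall>y. Q * y * P = 0 \<longrightarrow> sq_trace (R * y) = 0"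
  proof (intro allI impI)
    fix y assume y: "Q * y * P = 0"
    have "R = (P + Q) * R * (P + Q)" by (simp add: one)
    also have "\<dots> = P * R * Q"
      using * by (simp only: distrib_left distrib_right) simp
    finally have "R * y = P * (R * Q * y)" by (metis mult.assoc)
    then have "sq_trace (R * y) = sq_trace (R * Q * y * P)" by (metis sq_trace_commute)
    also have "R * Q * y * P = R * (Q * y * P)" by (simp only: mult.assoc)
    finally show "sq_trace (R * y) = 0" by (simp add: y)
  qed
qed

text \<open>F(y) = F([h, y]) says that M - [M, h] is orthogonal to the stabilizer of U, so three of
  its blocks vanish; these are \<open>eqA\<close>, \<open>eqC\<close> and
  \<open>eqD\<close>.\<close>

lemma principal_blocks_exist:
  assumes h: "principal_element L F (to_matrix h)"
  obtains A C D where "principal_blocks P Q A C D (P * h * P) (Q * h * Q) (P * h * Q)"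
proof -
  obtain M where M: "\<And>x. to_matrix x \<in> L \<Longrightarrow> F (to_matrix x) = sq_trace (M * x)" and trM: "sq_trace M = 0"
    using representing_matrix by blast
  have trace_bracket: "sq_trace (M * (x * y - y * x)) = sq_trace ((M * x - x * M) * y)" for x y
    using sq_trace_commute[of "M * y" x]
    by (simp add: right_diff_distrib left_diff_distrib sq_trace_minus mult.assoc)
  have hL: "sq_trace h = 0" "Q * h * P = 0"
    using h by (simp_all add: principal_element_def L)
  have hP: "h * P = P * h * P" and Qh: "Q * h = Q * h * Q"
  proof -
    have "h * P = (P + Q) * h * P" by (simp add: one)
    then show "h * P = P * h * P" by (simp add: distrib_right hL)
    have "Q * h = Q * h * (P + Q)" by (simp add: one)
    then show "Q * h = Q * h * Q" by (simp add: distrib_left hL)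
  qed
  define R where "R = M - (M * h - h * M)"
  have "\<forall>y. Q * y * P = 0 \<longrightarrow> sq_trace (R * y) = 0"
  proof (intro allI impI)
    fix y assume y: "Q * y * P = 0"
    define y0 where "y0 = traceless y"
    have y0L: "to_matrix y0 \<in> L" unfolding y0_def by (rule traceless_L[OF y])
    have "F (to_matrix y0) = F (to_matrix (h * y0 - y0 * h))"
      using h y0L by (simp add: principal_element_def flip: to_matrix_lie)
    moreover have "to_matrix (h * y0 - y0 * h) \<in> L"
      using commutator_L hL y0L by (simp add: L)
    ultimately have "sq_trace (R * y0) = 0"
      using M[OF y0L] M trace_bracket[of h y0] by (simp add: R_def left_diff_distrib sq_trace_minus)
    \<comment> \<open>This extends the orthogonality from sl to gl: R has trace 0 because M is
      traceless and commutators are too.\<close>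
    moreover have "sq_trace (R * sq_scalar c) = 0" for c
      using sq_trace_scalar_mult[of c R] sq_trace_commute[of M h]
      by (simp add: sq_scalar_commute R_def sq_trace_minus trM)
    moreover obtain c where "y = y0 + sq_scalar c"
      unfolding y0_def traceless_def by (metis diff_add_cancel)
    ultimately show "sq_trace (R * y) = 0"
      by (simp add: distrib_left sq_trace_add)
  qed
  then have R: "P * R * P = 0" "Q * R * P = 0" "Q * R * Q = 0"
    unfolding annihilator by blast+
  note ring = mult.assoc distrib_left distrib_right right_diff_distrib left_diff_distrib
  note idem = PP QQ PQ QP PP[THEN mult_extend] QQ[THEN mult_extend] PQ[THEN mult_extend] QP[THEN mult_extend]
  have split: "x * (P * y) + x * (Q * y) = x * y" for x y
  proof -
    have "x * (P * y) + x * (Q * y) = x * ((P + Q) * y)" by (simp only: ring)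
    then show ?thesis by (simp add: one)
  qed
  have stab: "n = 0 \<and> (\<exists>z. central z \<and> x = z * P \<and> y = z * Q)"
    if xyn: "in_corner P P x" "in_corner Q Q y" "in_corner P Q n"
      and eqs: "Q * M * P * x = y * (Q * M * P)" "P * M * P * x - x * (P * M * P) = n * (Q * M * P)"
        "y * (Q * M * Q) - Q * M * Q * y = Q * M * P * n"
    for x y n
  proof -
    have c: "P * x = x" "x * P = x" "Q * y = y" "y * Q = y" "P * n = n" "n * Q = n"
      using xyn by (auto simp: in_corner_def)
    have c0: "Q * x = 0" "x * Q = 0" "P * y = 0" "y * P = 0" "Q * n = 0" "n * P = 0"
      using c PQ QP by (metis mult.assoc mult_zero_left mult_zero_right)+
    note cs = c c0 c[THEN mult_extend] c0[THEN mult_extend]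
    \<comment> \<open>v preserves U and commutes with M up to the block Hom(W,U), so its traceless
      part lies in the radical of the Kirillov form and vanishes, leaving a scalar.\<close>
    define v where "v = x + y + n"
    have QvP: "Q * v * P = 0" by (simp add: v_def ring cs)
    have "P * (M * v - v * M) * P = 0" "Q * (M * v - v * M) * P = 0" "Q * (M * v - v * M) * Q = 0"
      using eqs by (simp_all add: v_def ring idem cs) (simp_all add: algebra_simps)
    then have bracket: "sq_trace ((M * v - v * M) * y') = 0" if "Q * y' * P = 0" for y'
      using that annihilator[of "M * v - v * M"] by blast
    define v0 where "v0 = traceless v"
    obtain c where v0: "v = v0 + sq_scalar c"
      unfolding v0_def traceless_def by (metis diff_add_cancel)
    have v0L: "to_matrix v0 \<in> L" unfolding v0_def by (rule traceless_L[OF QvP])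
    have "kirillov_form F (to_matrix v0) Y' = 0" if "Y' \<in> L" for Y'
    proof -
      obtain y' where y': "Y' = to_matrix y'" by (metis of_matrix_inverse[OF UNIV_I])
      have "Q * v0 * P = 0" "Q * y' * P = 0" using v0L that by (simp_all add: L y')
      then have "kirillov_form F (to_matrix v0) Y' = sq_trace (M * (v0 * y' - y' * v0))"
        by (simp add: kirillov_form_def y' to_matrix_lie M commutator_L)
      also have "v0 * y' - y' * v0 = v * y' - y' * v"
        by (simp add: v0 ring sq_scalar_commute)
      also have "sq_trace (M * (v * y' - y' * v)) = 0"
        using trace_bracket bracket \<open>Q * y' * P = 0\<close> by simp
      finally show ?thesis .
    qed
    then have "to_matrix v0 = 0"
      using F v0L unfolding frobenius_functional_def nondegenerate_on_def by blast
    then have v: "v = sq_scalar c"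
      using v0 by (metis add_0 to_matrix_inject zero_sqmat.rep_eq)
    have "P * v * P = x" "P * v * Q = n" "Q * v * Q = y" by (simp_all add: v_def ring cs)
    then show ?thesis
      unfolding v using central_scalar by (auto simp: sq_scalar_commute mult.assoc PP QQ PQ)
  qed
  have "principal_blocks P Q (P * M * P) (Q * M * P) (Q * M * Q) (P * h * P) (Q * h * Q) (P * h * Q)"
  proof unfold_locales
    show "in_corner P P (P * M * P)" "in_corner Q P (Q * M * P)" "in_corner Q Q (Q * M * Q)"
      "in_corner P P (P * h * P)" "in_corner Q Q (Q * h * Q)" "in_corner P Q (P * h * Q)"
      by (simp_all add: in_corner_def ring idem)
    have MR: "P * (M * h - h * M) * P = P * M * P" "Q * (M * h - h * M) * P = Q * M * P"
      "Q * (M * h - h * M) * Q = Q * M * Q"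
      using R by (simp_all add: R_def ring)
    show "Q * M * P * (P * h * P) - Q * h * Q * (Q * M * P) = Q * M * P"
    proof -
      have "Q * M * P * (P * h * P) - Q * h * Q * (Q * M * P) = Q * M * (P * h * P) - Q * h * Q * M * P"
        by (simp add: ring idem)
      also have "\<dots> = Q * (M * h - h * M) * P" unfolding hP[symmetric] Qh[symmetric] by (simp add: ring)
      also note MR(2)
      finally show ?thesis .
    qed
    show "P * M * P * (P * h * P) - P * h * P * (P * M * P) - P * h * Q * (Q * M * P) = P * M * P"
    proof -
      have "P * M * P * (P * h * P) - P * h * P * (P * M * P) - P * h * Q * (Q * M * P)
          = P * M * (P * h * P) - (P * h * (P * (M * P)) + P * h * (Q * (M * P)))"
        by (simp add: ring idem)
      also have "\<dots> = P * (M * h - h * M) * P" unfolding hP[symmetric] split by (simp add: ring)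
      also note MR(1)
      finally show ?thesis .
    qed
    show "Q * M * P * (P * h * Q) + Q * M * Q * (Q * h * Q) - Q * h * Q * (Q * M * Q) = Q * M * Q"
    proof -
      have "Q * M * P * (P * h * Q) + Q * M * Q * (Q * h * Q) - Q * h * Q * (Q * M * Q)
          = Q * M * (P * (h * Q)) + Q * M * (Q * (h * Q)) - Q * h * Q * M * Q"
        by (simp add: ring idem)
      also have "\<dots> = Q * (M * h - h * M) * Q" unfolding Qh[symmetric] split by (simp add: ring)
      also note MR(3)
      finally show ?thesis .
    qed
  qed (use PP QQ PQ QP stab in \<open>simp_all only:\<close>)
  with that show ?thesis by blast
qed

end

section \<open>From gl to sl, and the conclusion\<close>

lemma cmat_dim_traceless:
  fixes V :: "(complex^'n::finite^'n) set"
  assumes V: "cmat.subspace V" and one: "mat 1 \<in> V"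
  shows "cmat.dim V = Suc (cmat.dim {x \<in> V. trace x = 0})"
proof -
  let ?W = "{x \<in> V. trace x = 0}"
  have tr_scale: "trace (cmat_scale c x) = c * trace x" for c and x :: "complex^'n^'n"
    by (simp add: trace_def sum_distrib_left)
  obtain B where B: "B \<subseteq> ?W" "cmat.independent B" "?W \<subseteq> cmat.span B" "card B = cmat.dim ?W"
    by (rule cmat.basis_exists[of ?W])
  have W: "cmat.subspace ?W"
    using V by (auto simp: cmat.subspace_def trace_add tr_scale) (simp add: trace_def)
  have span: "cmat.span B = ?W"
    using B W cmat.span_minimal by blast
  have tr1: "trace (mat 1 :: complex^'n^'n) \<noteq> 0" by (simp add: trace_I)
  then have notin: "mat 1 \<notin> cmat.span B" using span by simp
  then have indep: "cmat.independent (insert (mat 1) B)"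
    using B(2) cmat.independent_insertI by blast
  have "V \<subseteq> cmat.span (insert (mat 1) B)"
  proof
    fix x assume x: "x \<in> V"
    let ?c = "trace x / trace (mat 1 :: complex^'n^'n)"
    have "x - cmat_scale ?c (mat 1) \<in> ?W"
      using x V one tr1 by (simp add: cmat.subspace_diff cmat.subspace_scale trace_sub tr_scale)
    then have "x - cmat_scale ?c (mat 1) \<in> cmat.span B" using span by blast
    then show "x \<in> cmat.span (insert (mat 1) B)" by (auto simp: cmat.span_insert)
  qed
  then have "cmat.dim V = card (insert (mat 1) B)"
    using B one indep by (intro cmat.basis_card_eq_dim[symmetric]) auto
  also have "\<dots> = Suc (card B)"
    using cmat_finite_independent[OF B(2)]
  proof (rule card_insert_disjoint)
    show "mat 1 \<notin> B" using notin cmat.span_base by blast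
  qed
  finally show ?thesis by (simp only: B(4))
qed

theorem theorem16:
  fixes F :: "complex^('a::finite + 'b::finite)^('a + 'b) \<Rightarrow> complex"
    and Fhat :: "complex^('a + 'b)^('a + 'b)"
    and d \<delta> :: "int \<Rightarrow> nat"
  assumes "frobenius (parabolic :: (complex^('a + 'b)^('a + 'b)) set)"
    and "frobenius_functional parabolic F"
    and "principal_element parabolic F Fhat"
    and "\<And>l. d l = cmat.dim (ad_eigenspace parabolic Fhat (of_int l))"
    and "\<And>l. \<delta> l = cmat.dim (ad_eigenspace gl Fhat (of_int l))"
  shows "((\<forall>l. d l = d (1 - l)) \<and> (\<forall>l\<le>-1. d l \<le> d (l + 1)) \<and> (\<forall>l\<ge>1. d l \<ge> d (l + 1))) \<and>
         ((\<forall>l. \<delta> l = \<delta> (- l)) \<and> (\<forall>l\<le>-1. \<delta> l \<le> \<delta> (l + 1)) \<and> (\<forall>l\<ge>0. \<delta> l \<ge> \<delta> (l + 1)))"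
proof -
  define P :: "('a + 'b) sqmat" where "P = sq_projection (range Inl)"
  define Q :: "('a + 'b) sqmat" where "Q = sq_projection (range Inr)"
  define h where "h = of_matrix Fhat"
  have h: "to_matrix h = Fhat" by (simp add: h_def of_matrix_inverse)
  have disj: "range Inl \<inter> range Inr = ({} :: ('a + 'b) set)" by auto
  have flag: "Q * x * P = 0 \<longleftrightarrow> (\<forall>i j. to_matrix x $ Inr i $ Inl j = 0)" for x
  proof -
    have "Q * x * P = 0 \<longleftrightarrow> to_matrix (Q * x * P) = 0"
      by (metis to_matrix_inject zero_sqmat.rep_eq)
    also have "\<dots> \<longleftrightarrow> (\<forall>i j. to_matrix x $ Inr i $ Inl j = 0)"
      by (auto simp: vec_eq_iff P_def Q_def to_matrix_projections)
    finally show ?thesis .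
  qed
  interpret graded_frobenius P Q F parabolic
  proof
    show "P * P = P" "Q * Q = Q" "P * Q = 0" "Q * P = 0"
      using disj by (simp_all add: P_def Q_def sq_projection_simps Int_commute)
    show "P + Q = 1"
      using disj by (simp add: P_def Q_def sq_projection_simps flip: UNIV_sum)
    show "to_matrix x \<in> parabolic \<longleftrightarrow> sq_trace x = 0 \<and> Q * x * P = 0" for x
      by (simp add: parabolic_def sl_def flag sq_trace.rep_eq)
    show "frobenius_functional parabolic F" by fact
  qed
  obtain A C D where pb: "principal_blocks P Q A C D (P * h * P) (Q * h * Q) (P * h * Q)"
    using principal_blocks_exist[of h] assms(3) h by auto
  have "P + Q \<noteq> 0" by (simp add: one)
  then obtain u w where uw: "weight_pair u w"
    and wd: "weight_data sq_trace P Q (P * h * P) (Q * h * Q) (P * h * Q) u w"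
    using weight_data_exists[OF pb] by blast
  have bal: "balanced u w" by (rule weight_pair_balanced[OF uw])
  have QhP: "Q * h * P = 0" using assms(3) L[of h] h by (simp add: principal_element_def)
  have split_h: "P * h * P + Q * h * Q + P * h * Q = h"
  proof -
    have "h = (P + Q) * h * (P + Q)" by (simp add: one)
    also have "\<dots> = P * h * P + Q * h * Q + P * h * Q"
      by (simp only: distrib_left distrib_right QhP) (simp add: algebra_simps)
    finally show ?thesis by simp
  qed
  interpret principal_blocks P Q A C D "P * h * P" "Q * h * Q" "P * h * Q" by fact
  note dims = eigenspace_dims[OF PP QQ PQ QP one X Y wd, unfolded split_h]
  have eigen: "lie Fhat (to_matrix x) = cmat_scale (of_int l) (to_matrix x) \<longleftrightarrow> h * x - x * h = of_int l * x" for x l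
    unfolding h[symmetric] to_matrix_lie to_matrix_scalar_mult[symmetric] to_matrix_inject by simp
  have ex: "\<exists>x. X = to_matrix x" for X :: "complex^('a + 'b)^('a + 'b)"
    by (metis of_matrix_inverse[OF UNIV_I])
  have "ad_eigenspace gl Fhat (of_int l) = {to_matrix x | x. h * x - x * h = of_int l * x}" for l
    using ex eigen by (fastforce simp: ad_eigenspace_def gl_def)
  then have \<delta>: "\<delta> l = total_corr u w l" for l
    using corr_commute[of w u l] bal by (simp add: assms(5) dims total_corr_def balanced_def)
  \<comment> \<open>The eigenspace on the stabilizer of U in gl, before the trace condition is
    imposed.\<close>
  define V where "V l = {to_matrix x | x. Q * x * P = 0 \<and> h * x - x * h = of_int l * x}" for l :: int
  have V: "ad_eigenspace parabolic Fhat (of_int l) = {X \<in> V l. trace X = 0}" for l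
  proof (rule set_eqI)
    fix X :: "complex^('a + 'b)^('a + 'b)"
    obtain x where x: "X = to_matrix x" using ex by blast
    have "to_matrix x \<in> V l \<longleftrightarrow> Q * x * P = 0 \<and> h * x - x * h = of_int l * x"
      by (auto simp only: V_def to_matrix_inject mem_Collect_eq)
    then show "X \<in> ad_eigenspace parabolic Fhat (of_int l) \<longleftrightarrow> X \<in> {X \<in> V l. trace X = 0}"
      unfolding x ad_eigenspace_def mem_Collect_eq L eigen sq_trace.rep_eq by blast
  qed
  have d: "d l + of_bool (l = 0) = corr u u l + corr w w l + corr u w l" for l
  proof (cases "l = 0")
    case True
    \<comment> \<open>The identity matrix commutes with h, so at weight 0 the trace condition costs
      exactly one dimension; this is the -1 in a + b + c - 1.\<close>
    have "cmat.subspace (V 0)"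
      unfolding cmat.subspace_def
    proof (intro conjI allI ballI)
      show "0 \<in> V 0" by (auto simp: V_def intro!: exI[of _ 0] simp: zero_sqmat.rep_eq)
    next
      fix X Y assume "X \<in> V 0" "Y \<in> V 0"
      then obtain x y where "X = to_matrix x" "Y = to_matrix y" "Q * x * P = 0" "Q * y * P = 0"
        "h * x = x * h" "h * y = y * h"
        by (auto simp: V_def)
      then show "X + Y \<in> V 0"
        by (auto simp: V_def distrib_left distrib_right plus_sqmat.rep_eq intro!: exI[of _ "x + y"])
    next
      fix c X assume "X \<in> V 0"
      then obtain x where "X = to_matrix x" "Q * x * P = 0" "h * x = x * h" by (auto simp: V_def)
      then show "cmat_scale c X \<in> V 0"
        by (auto simp: V_def scalar_flag sq_scalar_commute_left mult.assoc to_matrix_scalar_mult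
            intro!: exI[of _ "sq_scalar c * x"])
    qed
    moreover have "mat 1 \<in> V 0"
      by (auto simp: V_def QP one_sqmat.rep_eq intro!: exI[of _ 1])
    ultimately show ?thesis
      using True cmat_dim_traceless[of "V 0"] dims(2)[of 0] assms(4)[of 0] V[of 0] by (simp add: V_def)
  next
    case False
    \<comment> \<open>For l non-zero an eigenvector is a multiple of a commutator with h, so it is
      traceless and no dimension is lost.\<close>
    have "trace X = 0" if X: "X \<in> V l" for X
    proof -
      obtain x where x: "X = to_matrix x" "h * x - x * h = of_int l * x" using X by (auto simp: V_def)
      have "sq_trace (sq_scalar (of_int l) * x) = 0"
        using x(2) by (simp flip: x(2)) (simp add: sq_trace_minus sq_trace_commute[of h])
      then show ?thesis using False x(1) by (simp only: sq_trace_scalar_mult) (simp add: sq_trace.rep_eq)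
    qed
    then have "{X \<in> V l. trace X = 0} = V l" by blast
    then show ?thesis using False dims(2)[of l] assms(4)[of l] V[of l] by (simp add: V_def)
  qed
  show ?thesis by (rule balanced_unimodal[OF bal d \<delta>])
qed

end
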